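(* Let $\mathcal{K}$ be a field, let $r\ge5$ and $k\ge1$ be integers, and let $$\mathcal{R}=\mathcal{K}[s^{2r+1},\ s^{r+1}t^{r},\ s^{3}t^{2r-2},\ s^{2}t^{2r-1},\ t^{2r+1}]\subseteq\mathcal{K}[s,t].$$ If $\mathcal{R}$ is strictly $k$-Buchsbaum, then $\operatorname{reg}(\mathcal{R})=k+2$.
   Context: $\mathcal{R}$ has the standard grading in which the five listed monomials have degree one; $\mathfrak{m}$ is the homogeneous maximal ideal generated by them. For $k\ge 1$, $\mathcal{R}$ is strictly $k$-Buchsbaum if $k$ is the least integer with $\mathfrak{m}^kH^1_{\mathfrak{m}}(\mathcal{R})=0$, i.e. $\mathfrak{m}^kH^1_{\mathfrak{m}}(\mathcal{R})=0$ but $\mathfrak{m}^{k-1}H^1_{\mathfrak{m}}(\mathcal{R})\neq0$ (with $\mathfrak{m}^0=\mathcal{R}$). $\operatorname{reg}(\mathcal{R})=\max\{i+j: H^i_{\mathfrak{m}}(\mathcal{R})_j\neq0\}$ is the Castelnuovo-Mumford regularity. *)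

theory Defs
  imports Complex_Main "HOL-Library.Poly_Mapping" "HOL-Library.Product_Plus"
begin

section \<open>Laurent polynomials in two variables\<close>

text \<open>
  The Laurent polynomial ring \<open>K[s, 1/s, t, 1/t]\<close>, in which all rings and localizations below
  are subsets. Exponents are pairs of integers, and \<open>K[s,t]\<close> consists of the elements all of
  whose exponents are nonnegative.
\<close>

type_synonym 'k laurent2 = "(int \<times> int) \<Rightarrow>\<^sub>0 'k"

definition lconst :: "'k::field \<Rightarrow> 'k laurent2" where
  "lconst c = Poly_Mapping.single (0, 0) c"

definition st_monom :: "int \<Rightarrow> int \<Rightarrow> 'k::field laurent2" where
  "st_monom a b = Poly_Mapping.single (a, b) 1"

definition is_subalgebra :: "'k::field laurent2 set \<Rightarrow> bool" where
  "is_subalgebra A \<longleftrightarrow>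
     range lconst \<subseteq> A \<and> (\<forall>f\<in>A. \<forall>g\<in>A. f + g \<in> A \<and> f * g \<in> A)"

definition subalgebra_generated :: "'k::field laurent2 list \<Rightarrow> 'k laurent2 set" where
  "subalgebra_generated xs = is_subalgebra hull set xs"


section \<open>Ideals of a subring\<close>

definition is_ideal_of :: "'a::comm_ring_1 set \<Rightarrow> 'a set \<Rightarrow> bool" where
  "is_ideal_of R I \<longleftrightarrow>
     I \<subseteq> R \<and> 0 \<in> I \<and> (\<forall>f\<in>I. \<forall>g\<in>I. f + g \<in> I) \<and> (\<forall>a\<in>R. \<forall>f\<in>I. a * f \<in> I)"

definition ideal_generated :: "'a::comm_ring_1 set \<Rightarrow> 'a set \<Rightarrow> 'a set" where
  "ideal_generated R S = is_ideal_of R hull S"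

primrec ideal_pow :: "'a::comm_ring_1 set \<Rightarrow> 'a set \<Rightarrow> nat \<Rightarrow> 'a set" where
  "ideal_pow R I 0 = R"
| "ideal_pow R I (Suc k) = ideal_generated R {f * g | f g. f \<in> ideal_pow R I k \<and> g \<in> I}"


section \<open>Local cohomology via the Cech complex\<close>

text \<open>
  For a subring \<open>R\<close> of an ambient commutative ring in which \<open>x \<in> R\<close> is invertible, this is the
  localization of \<open>R\<close> at the powers of \<open>x\<close>: the set of all fractions \<open>f = a / x ^ n\<close> with
  \<open>a \<in> R\<close>. It must not be used for elements that are not units of the ambient ring.
\<close>

definition localization :: "'a::comm_ring_1 set \<Rightarrow> 'a \<Rightarrow> 'a set" where
  "localization R x = {f. \<exists>a\<in>R. \<exists>n. x ^ n * f = a}"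

text \<open>
  The Cech complex of \<open>R\<close> on a list \<open>xs\<close> of elements. An element of
  \<open>C^i = \<Oplus>_{|I| = i} R_{x_I}\<close>, where \<open>x_I\<close> is the product of the \<open>xs ! l\<close> with \<open>l \<in> I\<close>, is
  represented as a function on index sets that is zero outside the relevant ones.
\<close>

definition cech_cochains :: "'a::comm_ring_1 set \<Rightarrow> 'a list \<Rightarrow> nat \<Rightarrow> (nat set \<Rightarrow> 'a) set" where
  "cech_cochains R xs i =
     {c. \<forall>I. if I \<subseteq> {..<length xs} \<and> card I = i
             then c I \<in> localization R (\<Prod>l\<in>I. xs ! l)
             else c I = 0}"

definition cech_d :: "'a::comm_ring_1 list \<Rightarrow> (nat set \<Rightarrow> 'a) \<Rightarrow> nat set \<Rightarrow> 'a" where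
  "cech_d xs c J =
     (if J \<subseteq> {..<length xs}
      then \<Sum>l\<in>J. (-1) ^ card {m \<in> J. m < l} * c (J - {l})
      else 0)"

definition cech_cocycles :: "'a::comm_ring_1 set \<Rightarrow> 'a list \<Rightarrow> nat \<Rightarrow> (nat set \<Rightarrow> 'a) set" where
  "cech_cocycles R xs i = {c \<in> cech_cochains R xs i. cech_d xs c = (\<lambda>_. 0)}"

primrec cech_coboundaries :: "'a::comm_ring_1 set \<Rightarrow> 'a list \<Rightarrow> nat \<Rightarrow> (nat set \<Rightarrow> 'a) set" where
  "cech_coboundaries R xs 0 = {\<lambda>_. 0}"
| "cech_coboundaries R xs (Suc i) = cech_d xs ` cech_cochains R xs i"

definition cech_class :: "'a::comm_ring_1 set \<Rightarrow> 'a list \<Rightarrow> nat \<Rightarrow> (nat set \<Rightarrow> 'a) \<Rightarrow> (nat set \<Rightarrow> 'a) set"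
  where "cech_class R xs i z = {\<lambda>I. z I + b I | b. b \<in> cech_coboundaries R xs i}"

text \<open>
  The \<open>i\<close>-th local cohomology module of \<open>R\<close> with support in the ideal generated by \<open>xs\<close>, as the
  set of cosets of the coboundaries in the cocycles. Its zero element is the set
  \<^term>\<open>cech_coboundaries R xs i\<close> itself.
\<close>

definition local_cohomology ::
  "'a::comm_ring_1 set \<Rightarrow> 'a list \<Rightarrow> nat \<Rightarrow> (nat set \<Rightarrow> 'a) set set" where
  "local_cohomology R xs i = cech_class R xs i ` cech_cocycles R xs i"

definition lc_smult ::
  "'a::comm_ring_1 set \<Rightarrow> 'a list \<Rightarrow> nat \<Rightarrow> 'a \<Rightarrow> (nat set \<Rightarrow> 'a) set \<Rightarrow> (nat set \<Rightarrow> 'a) set" where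
  "lc_smult R xs i a h = (\<Union>z\<in>h. cech_class R xs i (\<lambda>I. a * z I))"

text \<open>
  For a grading \<open>L\<close> of the ambient ring (\<open>L j\<close> is the component of degree \<open>j\<close>) with \<open>R\<close> a graded
  subring and the \<open>xs\<close> homogeneous: the component of degree \<open>j\<close> of local cohomology, which
  consists of the classes of the homogeneous cocycles of degree \<open>j\<close>.
\<close>

definition local_cohomology_deg ::
  "(int \<Rightarrow> 'a::comm_ring_1 set) \<Rightarrow> 'a set \<Rightarrow> 'a list \<Rightarrow> nat \<Rightarrow> int \<Rightarrow> (nat set \<Rightarrow> 'a) set set" where
  "local_cohomology_deg L R xs i j =
     cech_class R xs i ` {z \<in> cech_cocycles R xs i. \<forall>I. z I \<in> L j}"


section \<open>Buchsbaum property and regularity\<close>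

definition annihilates_lc :: "'a::comm_ring_1 set \<Rightarrow> 'a list \<Rightarrow> 'a set \<Rightarrow> nat \<Rightarrow> bool" where
  "annihilates_lc R xs I i \<longleftrightarrow>
     (\<forall>a\<in>I. \<forall>h\<in>local_cohomology R xs i. lc_smult R xs i a h = cech_coboundaries R xs i)"

text \<open>
  In the next two definitions \<open>xs\<close> generates the homogeneous maximal ideal. Only the first local
  cohomology module enters, so this is the notion for rings of dimension two.
\<close>

definition strictly_Buchsbaum :: "'a::comm_ring_1 set \<Rightarrow> 'a list \<Rightarrow> nat \<Rightarrow> bool" where
  "strictly_Buchsbaum R xs k \<longleftrightarrow>
     k \<ge> 1 \<and>
     annihilates_lc R xs (ideal_pow R (ideal_generated R (set xs)) k) 1 \<and>
     \<not> annihilates_lc R xs (ideal_pow R (ideal_generated R (set xs)) (k - 1)) 1"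

definition cm_regularity :: "(int \<Rightarrow> 'a::comm_ring_1 set) \<Rightarrow> 'a set \<Rightarrow> 'a list \<Rightarrow> int" where
  "cm_regularity L R xs =
     (GREATEST n. \<exists>i j. n = int i + j \<and>
        local_cohomology_deg L R xs i j \<noteq> {cech_coboundaries R xs i})"


section \<open>The monomial curve\<close>

definition curve_gens :: "nat \<Rightarrow> 'k::field laurent2 list" where
  "curve_gens r =
     [st_monom (2 * int r + 1) 0,
      st_monom (int r + 1) (int r),
      st_monom 3 (2 * int r - 2),
      st_monom 2 (2 * int r - 1),
      st_monom 0 (2 * int r + 1)]"

definition curve_ring :: "nat \<Rightarrow> 'k::field laurent2 set" where
  "curve_ring r = subalgebra_generated (curve_gens r)"

text \<open>
  The generators all have total degree \<open>2 r + 1\<close> in \<open>s, t\<close>, so the standard grading is the total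
  degree divided by \<open>2 r + 1\<close>.
\<close>

definition curve_grading :: "nat \<Rightarrow> int \<Rightarrow> 'k::field laurent2 set" where
  "curve_grading r j = {f. \<forall>(a, b)\<in>Poly_Mapping.keys f. a + b = (2 * int r + 1) * j}"

lemma curve_gens_degree: "set (curve_gens r) \<subseteq> curve_grading r 1"
  by (auto simp: curve_gens_def curve_grading_def st_monom_def)

lemma lconst_degree: "lconst c \<in> curve_grading r 0"
  by (auto simp: curve_grading_def lconst_def)

lemma curve_grading_mult:
  assumes "f \<in> curve_grading r i" and "g \<in> curve_grading r j"
  shows "f * g \<in> curve_grading r (i + j)"
proof -
  have "a + b = (2 * int r + 1) * (i + j)" if ab: "(a, b) \<in> Poly_Mapping.keys (f * g)" for a b
  proof -
    obtain p q where pq: "p \<in> Poly_Mapping.keys f" "q \<in> Poly_Mapping.keys g" "(a, b) = p + q"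
      using subsetD[OF keys_mult ab] by blast
    have "fst p + snd p = (2 * int r + 1) * i" "fst q + snd q = (2 * int r + 1) * j"
      using assms pq(1,2) by (auto simp: curve_grading_def)
    moreover have "a = fst p + fst q" "b = snd p + snd q"
      using pq(3) by (simp_all add: prod_eq_iff)
    ultimately show ?thesis
      by (simp add: algebra_simps)
  qed
  then show ?thesis
    by (auto simp: curve_grading_def)
qed

end

theory Submission
  imports Defs
begin

text \<open>
  Everything here is spanned by monomials, so it is read off from exponents. Write \<open>d = 2 r + 1\<close>
  and \<open>q = \<lfloor>(r + 1) / 3\<rfloor>\<close>. The ring is spanned by the monomials with exponents in the semigroup
  generated by \<open>(d, 0)\<close>, \<open>(r + 1, r)\<close>, \<open>(3, 2 r - 2)\<close>, \<open>(2, 2 r - 1)\<close>, \<open>(0, d)\<close>.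

  Inverting \<open>s ^ d\<close> only constrains the exponent of \<open>t\<close>, which must lie in the numerical semigroup
  \<open>\<langle>r, 2 r - 2, 2 r - 1, 2 r + 1\<rangle>\<close>. Inverting \<open>t ^ d\<close> only constrains the exponent of \<open>s\<close>, which
  must lie in \<open>\<langle>2, 3\<rangle>\<close>, that is, be nonnegative and different from \<open>1\<close>. Inverting any other product
  of generators gives all Laurent monomials whose total degree is a multiple of \<open>d\<close>. A contraction
  of the Cech complex therefore leaves only two local cohomology modules to compute: \<open>H\<^sup>1\<close> is the
  intersection of the two localizations modulo the ring, and \<open>H\<^sup>2\<close> is the span of the whole lattice
  modulo the sum of the two localizations.

  The heart of the proof is the arithmetic of these semigroups. The lemma
  \<open>curve_semigroup_saturation\<close> shows that a monomial in both localizations lies in the ring unless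
  its exponent of \<open>s\<close> is \<open>r + 2\<close> and its degree \<open>n\<close> satisfies \<open>2 \<le> n \<le> q\<close>, and
  \<open>curve_semigroup_gap\<close> shows that these monomials are indeed missing. So \<open>H\<^sup>1\<close> is one-dimensional
  in each of the degrees \<open>2, \<dots>, q\<close>, and multiplication by \<open>t ^ d\<close> maps each of these lines onto the
  next one. Hence the \<open>k\<close>-th power of the maximal ideal kills \<open>H\<^sup>1\<close> exactly if \<open>q \<le> k + 1\<close>
  (\<open>curve_annihilates_lc_iff\<close>), and being strictly \<open>k\<close>-Buchsbaum means \<open>k = q - 1\<close>. On the other
  hand the conductor bound \<open>t_semigroup_conductor\<close> implies that \<open>H\<^sup>2\<close> vanishes in all degrees
  \<open>\<ge> q\<close>, so that \<open>H\<^sup>2\<close> contributes at most \<open>q + 1\<close> to the regularity, while the top degree \<open>q\<close> of \<open>H\<^sup>1\<close>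
  contributes exactly \<open>q + 1\<close>. The regularity is therefore \<open>q + 1 = k + 2\<close>.
\<close>


section \<open>The exponent semigroup of the curve\<close>

text \<open>
  Of the nonnegative integers up to \<open>3 m\<close>, only \<open>1\<close> is not a sum of at most \<open>m\<close> twos and threes:
  take as few twos as the residue modulo \<open>3\<close> permits.
\<close>

lemma two_three_sum:
  fixes c m :: int
  assumes "0 \<le> c" "c \<le> 3 * m" "c \<noteq> 1"
  obtains u v where "u \<ge> 0" "v \<ge> 0" "c = 2 * u + 3 * v" "u + v \<le> m"
proof
  show "(- c) mod 3 \<ge> 0" "(c - 2 * ((- c) mod 3)) div 3 \<ge> 0"
    "c = 2 * ((- c) mod 3) + 3 * ((c - 2 * ((- c) mod 3)) div 3)"
    "(- c) mod 3 + (c - 2 * ((- c) mod 3)) div 3 \<le> m"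
    using assms by presburger+
qed

definition curve_semigroup :: "nat \<Rightarrow> (int \<times> int) set" where
  "curve_semigroup r =
     {(a, b). \<exists>(x0::nat) (x1::nat) (x2::nat) (x3::nat) (x4::nat).
        a = (2 * int r + 1) * x0 + (int r + 1) * x1 + 3 * int x2 + 2 * int x3 \<and>
        b = int r * x1 + (2 * int r - 2) * x2 + (2 * int r - 1) * x3 + (2 * int r + 1) * x4}"

text \<open>
  The numerical semigroup of the exponents of \<open>t\<close>, which remains when the powers of \<open>s\<close> are
  invertible.
\<close>

definition t_semigroup :: "nat \<Rightarrow> int set" where
  "t_semigroup r =
     {b. \<exists>(x1::nat) (x2::nat) (x3::nat) (x4::nat).
        b = int r * x1 + (2 * int r - 2) * x2 + (2 * int r - 1) * x3 + (2 * int r + 1) * x4}"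

text \<open>
  In degree \<open>i + j + m\<close>: use \<open>i\<close> times the generator with \<open>s\<close>-exponent \<open>2 r + 1\<close>, \<open>j\<close> times the one
  with \<open>r + 1\<close>, and spread \<open>c\<close> over the remaining \<open>m\<close> generators with \<open>s\<close>-exponents \<open>3\<close>, \<open>2\<close>, \<open>0\<close>.
\<close>

lemma curve_semigroupI:
  assumes "i \<ge> 0" "j \<ge> 0" "0 \<le> c" "c \<le> 3 * m" "c \<noteq> 1"
    and a: "a = (2 * int r + 1) * i + (int r + 1) * j + c"
    and ab: "a + b = (2 * int r + 1) * (i + j + m)"
  shows "(a, b) \<in> curve_semigroup r"
proof -
  obtain u v where uv: "u \<ge> 0" "v \<ge> 0" "c = 2 * u + 3 * v" "u + v \<le> m"
    using two_three_sum assms(3-5) by metis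
  have b: "b = int r * j + (2 * int r - 2) * v + (2 * int r - 1) * u
      + (2 * int r + 1) * (m - u - v)"
    using a ab uv(3) by (simp add: algebra_simps)
  have "a = (2 * int r + 1) * int (nat i) + (int r + 1) * int (nat j)
      + 3 * int (nat v) + 2 * int (nat u)"
    using a uv assms(1,2) by simp
  moreover have "b = int r * int (nat j) + (2 * int r - 2) * int (nat v)
      + (2 * int r - 1) * int (nat u) + (2 * int r + 1) * int (nat (m - u - v))"
    using b uv assms(1,2) by simp
  ultimately show ?thesis
    unfolding curve_semigroup_def mem_Collect_eq prod.case by blast
qed

lemma curve_semigroup_zero: "(0, 0) \<in> curve_semigroup r"
  using curve_semigroupI[of 0 0 0 0] by simp

lemma curve_semigroup_add:
  assumes "p \<in> curve_semigroup r" "q \<in> curve_semigroup r"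
  shows "p + q \<in> curve_semigroup r"
proof -
  obtain x0 x1 x2 x3 x4 :: nat where x:
    "fst p = (2 * int r + 1) * x0 + (int r + 1) * x1 + 3 * int x2 + 2 * int x3"
    "snd p = int r * x1 + (2 * int r - 2) * x2 + (2 * int r - 1) * x3 + (2 * int r + 1) * x4"
    using assms(1) by (force simp: curve_semigroup_def)
  obtain y0 y1 y2 y3 y4 :: nat where y:
    "fst q = (2 * int r + 1) * y0 + (int r + 1) * y1 + 3 * y2 + 2 * y3"
    "snd q = int r * y1 + (2 * int r - 2) * y2 + (2 * int r - 1) * y3 + (2 * int r + 1) * y4"
    using assms(2) by (force simp: curve_semigroup_def)
  have "fst p + fst q = (2 * int r + 1) * int (x0 + y0) + (int r + 1) * int (x1 + y1)
      + 3 * int (x2 + y2) + 2 * int (x3 + y3)"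
    and "snd p + snd q = int r * int (x1 + y1) + (2 * int r - 2) * int (x2 + y2)
      + (2 * int r - 1) * int (x3 + y3) + (2 * int r + 1) * int (x4 + y4)"
    using x y by (simp_all add: algebra_simps)
  then show ?thesis
    unfolding curve_semigroup_def mem_Collect_eq case_prod_beta fst_add snd_add by blast
qed

lemma curve_semigroup_degree:
  assumes "(a, b) \<in> curve_semigroup r"
  obtains n where "n \<ge> 0" "a + b = (2 * int r + 1) * n"
proof -
  obtain x0 x1 x2 x3 x4 :: nat where x:
    "a = (2 * int r + 1) * x0 + (int r + 1) * x1 + 3 * int x2 + 2 * int x3"
    "b = int r * x1 + (2 * int r - 2) * x2 + (2 * int r - 1) * x3 + (2 * int r + 1) * x4"
    using assms by (auto simp: curve_semigroup_def)
  have "a + b = (2 * int r + 1) * int (x0 + x1 + x2 + x3 + x4)"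
    using x by (simp add: algebra_simps)
  with that[of "int (x0 + x1 + x2 + x3 + x4)"] show thesis by simp
qed

lemma curve_semigroup_fst:
  assumes "(a, b) \<in> curve_semigroup r" "r \<ge> 1"
  shows "a \<ge> 0" "a \<noteq> 1"
proof -
  obtain x0 x1 x2 x3 :: nat where x:
    "a = (2 * int r + 1) * x0 + (int r + 1) * x1 + 3 * int x2 + 2 * int x3"
    using assms by (auto simp: curve_semigroup_def)
  have le: "2 * int x0 \<le> (2 * int r + 1) * x0" "2 * int x1 \<le> (int r + 1) * x1"
    using \<open>r \<ge> 1\<close> by (auto intro!: mult_right_mono)
  then show "a \<ge> 0" using x by linarith
  show "a \<noteq> 1"
  proof (cases "x0 = 0 \<and> x1 = 0")
    case True
    then show ?thesis using x by presburger
  next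
    case False
    then show ?thesis using x le by linarith
  qed
qed

lemma curve_semigroup_snd: "(a, b) \<in> curve_semigroup r \<Longrightarrow> b \<in> t_semigroup r"
  by (auto simp: curve_semigroup_def t_semigroup_def)

lemma t_semigroup_eq: "t_semigroup r = snd ` curve_semigroup r"
proof
  show "snd ` curve_semigroup r \<subseteq> t_semigroup r" using curve_semigroup_snd by auto
  show "t_semigroup r \<subseteq> snd ` curve_semigroup r"
  proof
    fix b assume "b \<in> t_semigroup r"
    then obtain x1 x2 x3 x4 :: nat where
      "b = int r * x1 + (2 * int r - 2) * x2 + (2 * int r - 1) * x3 + (2 * int r + 1) * x4"
      by (auto simp: t_semigroup_def)
    then have "((2 * int r + 1) * int 0 + (int r + 1) * x1 + 3 * int x2 + 2 * int x3, b)
        \<in> curve_semigroup r"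
      unfolding curve_semigroup_def mem_Collect_eq prod.case by blast
    then show "b \<in> snd ` curve_semigroup r" by force
  qed
qed

lemma t_semigroup_add:
  assumes "b \<in> t_semigroup r" "b' \<in> t_semigroup r"
  shows "b + b' \<in> t_semigroup r"
proof -
  obtain a a' where "(a, b) \<in> curve_semigroup r" "(a', b') \<in> curve_semigroup r"
    using assms unfolding t_semigroup_eq by auto
  from curve_semigroup_add[OF this] show ?thesis unfolding t_semigroup_eq by force
qed

text \<open>
  Two copies of \<open>r\<close> make \<open>2 r\<close>, which lies in the block from \<open>2 r - 2\<close> to \<open>2 r + 1\<close> like the other
  generators. So an element consists of \<open>l\<close> summands from this block and at most one \<open>r\<close>.
\<close>

lemma t_semigroup_bounds:
  assumes "b \<in> t_semigroup r"
  obtains l p :: int where "l \<ge> 0" "p = 0 \<or> p = 1"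
    "l * (2 * int r - 2) + p * r \<le> b" "b \<le> l * (2 * int r + 1) + p * r"
proof -
  obtain x1 x2 x3 x4 :: nat where
    x: "b = int r * x1 + (2 * int r - 2) * x2 + (2 * int r - 1) * x3 + (2 * int r + 1) * x4"
    using assms by (auto simp: t_semigroup_def)
  define l p where "l = int (x1 div 2 + x2 + x3 + x4)" and "p = int (x1 mod 2)"
  have x1: "int x1 = 2 * int (x1 div 2) + p" unfolding p_def by presburger
  have b: "b = 2 * int r * int (x1 div 2) + p * r
      + (2 * int r - 2) * x2 + (2 * int r - 1) * x3 + (2 * int r + 1) * x4"
    unfolding x x1 by (simp add: algebra_simps)
  show thesis
    by (rule that[of l p]) (auto simp: l_def p_def b[unfolded p_def] algebra_simps)
qed

text \<open>
  Conversely, sums of \<open>l\<close> elements of the block \<open>2 r - 2, \<dots>, 2 r + 1\<close> fill the whole interval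
  between their extreme values.
\<close>

lemma t_semigroup_interval:
  fixes l p :: int
  assumes "l \<ge> 0" "p \<ge> 0"
    "l * (2 * int r - 2) + p * r \<le> b" "b \<le> l * (2 * int r + 1) + p * r"
  shows "b \<in> t_semigroup r"
proof -
  define c where "c = l * (2 * int r + 1) + p * r - b"
  have c: "0 \<le> c" "c \<le> 3 * l" using assms by (auto simp: c_def algebra_simps)
  show ?thesis
  proof (cases "c = 1")
    case True
    \<comment> \<open>The sum \<open>2 r\<close>, which is not a generator, is replaced by two copies of \<open>r\<close>.\<close>
    then have "b = int r * int (nat (p + 2)) + (2 * int r - 2) * int 0 + (2 * int r - 1) * int 0
        + (2 * int r + 1) * int (nat (l - 1))"
      using c assms(1,2) by (simp add: c_def algebra_simps)
    then show ?thesis unfolding t_semigroup_def mem_Collect_eq by blast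
  next
    case False
    then obtain u v where uv: "u \<ge> 0" "v \<ge> 0" "c = 2 * u + 3 * v" "u + v \<le> l"
      using two_three_sum c by metis
    then have "b = int r * int (nat p) + (2 * int r - 2) * int (nat v) + (2 * int r - 1) * int (nat u)
        + (2 * int r + 1) * int (nat (l - u - v))"
      using assms(1,2) by (simp add: c_def algebra_simps)
    then show ?thesis unfolding t_semigroup_def mem_Collect_eq by blast
  qed
qed

text \<open>
  The intervals of sums of \<open>l\<close> block elements, alternating with their translates by \<open>r\<close>, leave no
  gap from \<open>l = \<lfloor>(r + 1) / 3\<rfloor>\<close> on.
\<close>

lemma t_semigroup_conductor:
  assumes r: "r \<ge> 2" and b: "b > (2 * int r + 1) * ((int r + 1) div 3)"
  shows "b \<in> t_semigroup r"
proof -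
  define q l where "q = (int r + 1) div 3" and "l = b div (2 * int r - 2)"
  have q: "q \<ge> 0" "3 * q \<ge> int r - 1" unfolding q_def by presburger+
  have bq: "b > (2 * int r + 1) * q" using b by (simp add: q_def)
  have pos: "2 * int r - 2 > 0" using r by simp
  have l: "l * (2 * int r - 2) \<le> b" "b < (l + 1) * (2 * int r - 2)"
    using pos pos_mod_bound[OF pos, of b] pos_mod_sign[OF pos, of b] div_mult_mod_eq[of b "2 * int r - 2"]
    by (simp_all add: l_def algebra_simps)
  have "q * (2 * int r - 2) \<le> b" using bq q(1) by (simp add: algebra_simps)
  then have "q \<le> l" unfolding l_def using pos zdiv_mono1[of "q * (2 * int r - 2)" b "2 * int r - 2"] by simp
  show ?thesis
  proof (cases "b \<le> l * (2 * int r + 1)")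
    case True
    then show ?thesis using t_semigroup_interval[of l 0 r b] l \<open>q \<le> l\<close> q by simp
  next
    case False
    have "l * (2 * int r - 2) + 1 * r \<le> b" "b \<le> l * (2 * int r + 1) + 1 * r"
      using False l q \<open>q \<le> l\<close> by (simp_all add: algebra_simps)
    then show ?thesis using t_semigroup_interval[of l 1 r b] \<open>q \<le> l\<close> q by simp
  qed
qed

text \<open>
  Divide the exponent of \<open>s\<close> by \<open>d = 2 r + 1\<close> with remainder \<open>c\<close>, which leaves \<open>m\<close> factors for \<open>c\<close>.
  The description of the \<open>t\<close>-exponents by intervals shows that \<open>c\<close> is at most \<open>3 m\<close>, or at most
  \<open>3 (m - 1)\<close> after one factor of \<open>s\<close>-exponent \<open>r + 1\<close> is split off. The only obstruction is a
  leftover \<open>1\<close>, which the relation \<open>2 (r + 1) = d + 1\<close> absorbs if the quotient is positive. If the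
  quotient is \<open>0\<close>, the leftover is excluded by assumption or gives the exceptional monomials.
\<close>

lemma curve_semigroup_saturation:
  assumes r: "r \<ge> 2" and a: "a \<ge> 0" "a \<noteq> 1" and b: "b \<in> t_semigroup r"
    and n: "a + b = (2 * int r + 1) * n"
  shows "(a, b) \<in> curve_semigroup r \<or> (a = int r + 2 \<and> 2 \<le> n \<and> n \<le> (int r + 1) div 3)"
proof -
  define d where "d = 2 * int r + 1"
  define i c where "i = a div d" and "c = a mod d"
  define m where "m = n - i"
  have d: "d > 0" by (simp add: d_def)
  have a_eq: "a = d * i + c" by (simp add: i_def c_def)
  have c: "0 \<le> c" "c < d" using d by (auto simp: c_def)
  have i: "i \<ge> 0" using a d by (simp add: i_def pos_imp_zdiv_nonneg_iff)
  have b_eq: "b = d * m - c" using n a_eq by (simp add: m_def d_def algebra_simps)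
  have inI: "(a, b) \<in> curve_semigroup r"
    if "i' \<ge> 0" "j \<ge> 0" "0 \<le> c'" "c' \<le> 3 * (n - i' - j)" "c' \<noteq> 1"
      "a = d * i' + (int r + 1) * j + c'" for i' j c'
    using that n by (intro curve_semigroupI[of i' j c' "n - i' - j"]) (auto simp: d_def)
  obtain l p :: int where l: "l \<ge> 0" "p = 0 \<or> p = 1"
    "l * (2 * int r - 2) + p * r \<le> b" "b \<le> l * (2 * int r + 1) + p * r"
    using t_semigroup_bounds[OF b] by metis
  have low: "m * (2 * int r - 2) \<le> l * (2 * int r - 2)" if "m \<le> l"
    using that r by (intro mult_right_mono) auto
  have small: "(a, b) \<in> curve_semigroup r" if "c \<le> 3 * m"
  proof (cases "c = 1")
    case True
    then have "i \<ge> 1" "m \<ge> 1" using a a_eq i that by (auto intro: ccontr)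
    then show ?thesis using True
      by (intro inI[of "i - 1" 2 0]) (auto simp: a_eq m_def d_def algebra_simps)
  next
    case False
    then show ?thesis using that c i by (intro inI[of i 0 c]) (auto simp: a_eq m_def)
  qed
  show ?thesis
  proof (cases "m \<le> l")
    case True
    have "p * int r \<ge> 0" using l(2) by auto
    then have "c \<le> 3 * m"
      using l(3) low[OF True] unfolding b_eq d_def by (simp add: algebra_simps)
    with small show ?thesis by simp
  next
    case False
    have pr: "p * int r \<le> r" using l(2) by auto
    have "m = l + 1 \<and> p = 1"
    proof (rule ccontr)
      assume "\<not> (m = l + 1 \<and> p = 1)"
      then have "(m \<ge> l + 2 \<and> p \<ge> 0) \<or> (m = l + 1 \<and> p = 0)" using False l(2) by linarith
      then show False
      proof
        assume *: "m \<ge> l + 2 \<and> p \<ge> 0"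
        then have "d * (l + 2) \<le> d * m" using d by (intro mult_left_mono) auto
        then show False using l(4) pr c unfolding b_eq d_def by (simp add: algebra_simps)
      next
        assume *: "m = l + 1 \<and> p = 0"
        then show False using l(4) c unfolding b_eq d_def by (simp add: algebra_simps)
      qed
    qed
    then have ml: "m = l + 1" and p: "p = 1" by auto
    define e where "e = c - (int r + 1)"
    have e: "0 \<le> e" "e \<le> 3 * (m - 1)"
      using l(3,4) unfolding b_eq d_def ml p e_def by (simp_all add: algebra_simps)
    show ?thesis
    proof (cases "e = 1")
      case False
      then have "(a, b) \<in> curve_semigroup r" using e i
        by (intro inI[of i 1 e]) (auto simp: a_eq m_def e_def)
      then show ?thesis ..
    next
      case True
      then have c_eq: "c = int r + 2" and m2: "m \<ge> 2" using e by (auto simp: e_def)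
      show ?thesis
      proof (cases "i = 0")
        case False
        then have "(a, b) \<in> curve_semigroup r" using m2 i
          by (intro inI[of "i - 1" 3 0]) (auto simp: a_eq m_def c_eq d_def algebra_simps)
        then show ?thesis ..
      next
        case True
        then have *: "a = int r + 2" "m = n" using a_eq c_eq by (auto simp: m_def)
        show ?thesis
        proof (cases "c \<le> 3 * m")
          case False
          then have "n \<le> (int r + 1) div 3" using * c_eq by presburger
          then show ?thesis using * m2 by simp
        qed (use small in simp)
      qed
    qed
  qed
qed

text \<open>
  The number \<open>r + 2\<close> exceeds \<open>r + 1\<close> by the gap \<open>1\<close> of \<open>\<langle>2, 3\<rangle>\<close>, so it would have to be a sum of
  twos and threes, and that takes more than \<open>(r + 1) / 3\<close> summands.
\<close>

lemma curve_semigroup_gap: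
  assumes n: "3 * n \<le> int r + 1" and ab: "a = int r + 2" "a + b = (2 * int r + 1) * n" 
    and r: "r \<ge> 2"
  shows "(a, b) \<notin> curve_semigroup r"
proof
  assume "(a, b) \<in> curve_semigroup r"
  then obtain x0 x1 x2 x3 x4 :: nat where x:
    "a = (2 * int r + 1) * x0 + (int r + 1) * x1 + 3 * int x2 + 2 * int x3"
    "b = int r * x1 + (2 * int r - 2) * x2 + (2 * int r - 1) * x3 + (2 * int r + 1) * x4"
    by (auto simp: curve_semigroup_def)
  have "(2 * int r + 1) * n = (2 * int r + 1) * (int x0 + x1 + x2 + x3 + x4)"
    using ab(2) x by (simp add: algebra_simps)
  then have deg: "n = int x0 + x1 + x2 + x3 + x4"
    unfolding mult_cancel_left by linarith
  have "x0 = 0"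
  proof (rule ccontr)
    assume "x0 \<noteq> 0"
    then have "2 * int r + 1 \<le> (2 * int r + 1) * x0"
      using mult_left_mono[of 1 "int x0" "2 * int r + 1"] by simp
    moreover have "(int r + 1) * int x1 \<ge> 0" "int r \<ge> 2" using r by simp_all
    ultimately show False using x(1) ab(1) by linarith
  qed
  moreover have "x1 < 2"
  proof (rule ccontr)
    assume "\<not> x1 < 2"
    then have "2 * int r + 2 \<le> (int r + 1) * x1"
      using mult_left_mono[of 2 "int x1" "int r + 1"] by simp
    then show False using x(1) ab(1) r \<open>x0 = 0\<close> by simp
  qed
  then have "x1 = 0 \<or> x1 = 1" by linarith
  ultimately show False
  proof (elim disjE)
    assume "x0 = 0" "x1 = 1"
    then have "3 * int x2 + 2 * int x3 = 1" using x(1) ab(1) by simp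
    then show False by presburger
  next
    assume "x0 = 0" "x1 = 0"
    then have "int r + 2 = 3 * int x2 + 2 * int x3" using x(1) ab(1) by simp
    then show False using deg n by linarith
  qed
qed


section \<open>Spans of monomials\<close>

definition monomial_span :: "(int \<times> int) set \<Rightarrow> 'k::field laurent2 set" where
  "monomial_span T = {f. Poly_Mapping.keys f \<subseteq> T}"

lemma monomial_span_zero: "0 \<in> monomial_span T"
  by (simp add: monomial_span_def)

lemma monomial_span_add: "f \<in> monomial_span T \<Longrightarrow> g \<in> monomial_span T \<Longrightarrow> f + g \<in> monomial_span T"
  unfolding monomial_span_def using keys_add[of f g] by blast

lemma monomial_span_diff: "f \<in> monomial_span T \<Longrightarrow> g \<in> monomial_span T \<Longrightarrow> f - g \<in> monomial_span T"
  unfolding monomial_span_def using keys_diff[of f g] by blast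

lemma monomial_span_mono: "T \<subseteq> U \<Longrightarrow> monomial_span T \<subseteq> monomial_span U"
  by (auto simp: monomial_span_def)

lemma monomial_span_Int: "monomial_span (T \<inter> U) = monomial_span T \<inter> monomial_span U"
  by (auto simp: monomial_span_def)

lemma monomial_span_mult:
  assumes "f \<in> monomial_span T" "g \<in> monomial_span U"
    and "\<And>p q. p \<in> T \<Longrightarrow> q \<in> U \<Longrightarrow> p + q \<in> V"
  shows "f * g \<in> monomial_span V"
  using keys_mult[of f g] assms unfolding monomial_span_def by blast

lemma monomial_span_Un:
  assumes "f \<in> monomial_span (T \<union> U)"
  obtains g h where "g \<in> monomial_span T" "h \<in> monomial_span U" "f = g + h"
proof -
  let ?part = "\<lambda>A. \<Sum>p\<in>Poly_Mapping.keys f \<inter> A. Poly_Mapping.single p (Poly_Mapping.lookup f p)"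
  have lookup_part: "Poly_Mapping.lookup (?part A) p = (if p \<in> A then Poly_Mapping.lookup f p else 0)" for A p
    by (auto simp: lookup_sum lookup_single when_def sum.If_cases in_keys_iff sum.delta)
  show thesis
  proof (rule that)
    show "?part T \<in> monomial_span T" "?part (- T) \<in> monomial_span U"
      using assms unfolding monomial_span_def by (auto simp: in_keys_iff lookup_part split: if_splits)
    show "f = ?part T + ?part (- T)"
      by (rule poly_mapping_eqI) (simp add: lookup_add lookup_part)
  qed
qed

lemma st_monom_in_span [simp]: "st_monom a b \<in> monomial_span T \<longleftrightarrow> (a, b) \<in> T"
  by (simp add: monomial_span_def st_monom_def)

lemma st_monom_mult: "st_monom a b * st_monom c d = st_monom (a + c) (b + d)"
  by (simp add: st_monom_def mult_single)

lemma st_monom_zero: "st_monom 0 0 = 1"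
  by (simp add: st_monom_def flip: zero_prod_def)

lemma st_monom_power: "st_monom a b ^ n = st_monom (int n * a) (int n * b)"
  by (induction n) (simp_all add: st_monom_zero st_monom_mult algebra_simps)

lemma st_monom_prod: "(\<Prod>l\<in>I. st_monom (a l) (b l)) = st_monom (sum a I) (sum b I)"
  by (induction I rule: infinite_finite_induct) (simp_all add: st_monom_zero st_monom_mult)

text \<open>
  Multiplication by a Laurent monomial is invertible, so it only translates the exponents.
\<close>

lemma st_monom_mult_in_span:
  "st_monom a b * f \<in> monomial_span T \<longleftrightarrow> f \<in> monomial_span {p. (a, b) + p \<in> T}"
proof
  assume "st_monom a b * f \<in> monomial_span T"
  then have "st_monom (- a) (- b) * (st_monom a b * f) \<in> monomial_span {p. (a, b) + p \<in> T}"
    by (rule monomial_span_mult[of _ "{(- a, - b)}", rotated])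
      (auto simp: zero_prod_def[symmetric] add.assoc[symmetric])
  then show "f \<in> monomial_span {p. (a, b) + p \<in> T}"
    by (simp add: st_monom_mult st_monom_zero flip: mult.assoc)
next
  assume "f \<in> monomial_span {p. (a, b) + p \<in> T}"
  then show "st_monom a b * f \<in> monomial_span T"
    by (rule monomial_span_mult[of _ "{(a, b)}", rotated]) auto
qed

text \<open>
  Reduces statements about all elements of a span to statements about monomials.
\<close>

lemma monomial_expansion:
  fixes f :: "'a::field laurent2"
  shows
  "f = (\<Sum>p\<in>Poly_Mapping.keys f. lconst (Poly_Mapping.lookup f p) * st_monom (fst p) (snd p))"
proof -
  have "lconst c * st_monom (fst p) (snd p) = Poly_Mapping.single p c" for c :: 'a and p
    by (simp add: lconst_def st_monom_def mult_single flip: zero_prod_def)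
  then show ?thesis
    by (intro poly_mapping_eqI) (auto simp: lookup_sum lookup_single when_def in_keys_iff)
qed

lemma monomial_span_subset_subalgebra:
  fixes A :: "'a::field laurent2 set"
  assumes A: "is_subalgebra A" and T: "\<And>a b. (a, b) \<in> T \<Longrightarrow> st_monom a b \<in> A"
  shows "monomial_span T \<subseteq> A"
proof
  fix f :: "'a laurent2" assume "f \<in> monomial_span T"
  then have f: "Poly_Mapping.keys f \<subseteq> T" by (simp add: monomial_span_def)
  have "lconst 0 \<in> A" using A by (auto simp: is_subalgebra_def)
  then have zero: "0 \<in> A" by (simp add: lconst_def)
  have "(\<Sum>p\<in>K. lconst (Poly_Mapping.lookup f p) * st_monom (fst p) (snd p)) \<in> A"
    if "finite K" "K \<subseteq> T" for K
    using that
  proof (induction K)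
    case (insert p K)
    have "lconst (Poly_Mapping.lookup f p) \<in> A" "st_monom (fst p) (snd p) \<in> A"
      using A T insert.prems by (auto simp: is_subalgebra_def)
    then show ?case using insert A by (auto simp: is_subalgebra_def)
  qed (simp add: zero)
  from this[OF finite_keys f] show "f \<in> A"
    unfolding monomial_expansion[of f, symmetric] .
qed

lemma is_subalgebra_hull: "is_subalgebra (is_subalgebra hull X)"
  by (rule hull_in) (auto simp: is_subalgebra_def image_subset_iff)

lemma subalgebra_power_mult:
  assumes "is_subalgebra A" "x \<in> A" "y \<in> A"
  shows "x ^ n * y \<in> A"
  using assms by (induction n) (auto simp: is_subalgebra_def mult.assoc)

lemma curve_ring_eq: "curve_ring r = (monomial_span (curve_semigroup r) :: 'a::field laurent2 set)"
proof
  let ?A = "curve_ring r :: 'a laurent2 set"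
  let ?span = "monomial_span (curve_semigroup r) :: 'a laurent2 set"
  have "set (curve_gens r) \<subseteq> ?span"
    using curve_semigroupI[of 1 0 0 0 "2 * int r + 1" r 0]
      curve_semigroupI[of 0 1 0 0 "int r + 1" r "int r"]
      curve_semigroupI[of 0 0 3 1 "3" r "2 * int r - 2"]
      curve_semigroupI[of 0 0 2 1 "2" r "2 * int r - 1"]
      curve_semigroupI[of 0 0 0 1 "0" r "2 * int r + 1"]
    by (simp add: curve_gens_def)
  moreover have "is_subalgebra ?span"
    unfolding is_subalgebra_def
  proof (intro conjI ballI)
    show "range lconst \<subseteq> ?span"
      by (auto simp: lconst_def monomial_span_def curve_semigroup_zero split: if_splits)
  qed (auto intro: monomial_span_add monomial_span_mult curve_semigroup_add)
  ultimately show "?A \<subseteq> ?span"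
    unfolding curve_ring_def subalgebra_generated_def by (rule hull_minimal)
  have A: "is_subalgebra ?A"
    unfolding curve_ring_def subalgebra_generated_def by (rule is_subalgebra_hull)
  have gens: "set (curve_gens r) \<subseteq> ?A"
    unfolding curve_ring_def subalgebra_generated_def by (rule hull_subset)
  have one: "1 \<in> ?A" 
  proof -
    have "lconst 1 \<in> ?A" using A by (auto simp: is_subalgebra_def)
    then show ?thesis by (simp add: lconst_def flip: zero_prod_def)
  qed
  show "?span \<subseteq> ?A"
  proof (rule monomial_span_subset_subalgebra[OF A])
    fix a b assume "(a, b) \<in> curve_semigroup r"
    then obtain x0 x1 x2 x3 x4 :: nat where x:
      "a = (2 * int r + 1) * x0 + (int r + 1) * x1 + 3 * int x2 + 2 * int x3"
      "b = int r * x1 + (2 * int r - 2) * x2 + (2 * int r - 1) * x3 + (2 * int r + 1) * x4"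
      by (auto simp: curve_semigroup_def)
    have "st_monom a b = st_monom (2 * int r + 1) 0 ^ x0 * (st_monom (int r + 1) (int r) ^ x1
      * (st_monom 3 (2 * int r - 2) ^ x2 * (st_monom 2 (2 * int r - 1) ^ x3
      * (st_monom 0 (2 * int r + 1) ^ x4 * 1))))"
      unfolding st_monom_power x by (simp add: st_monom_mult algebra_simps)
    also have "\<dots> \<in> ?A"
      using gens one by (intro subalgebra_power_mult[OF A]) (auto simp: curve_gens_def)
    finally show "st_monom a b \<in> ?A" .
  qed
qed

lemma semigroup_multiple:
  assumes "0 \<in> S" "\<And>p q. p \<in> S \<Longrightarrow> q \<in> S \<Longrightarrow> p + q \<in> S" "(a, b) \<in> S"
  shows "(int n * a, int n * b) \<in> S"
proof (induction n)
  case (Suc n)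
  from assms(2)[OF this assms(3)] show ?case by (simp add: algebra_simps)
qed (use assms(1) in \<open>simp add: zero_prod_def\<close>)

text \<open>
  An element of the span has only finitely many exponents, so that one power of the inverted
  monomial clears the denominators of all of them.
\<close>

lemma localization_monomial_span:
  assumes S: "0 \<in> S" "\<And>p q. p \<in> S \<Longrightarrow> q \<in> S \<Longrightarrow> p + q \<in> S" and u: "(a, b) \<in> S"
  shows "localization (monomial_span S) (st_monom a b)
           = (monomial_span {p. \<exists>n::nat. (int n * a, int n * b) + p \<in> S} :: 'a::field laurent2 set)"
    (is "?loc = ?span")
proof
  show "?loc \<subseteq> ?span"
  proof
    fix f assume "f \<in> ?loc"
    then obtain n where "st_monom a b ^ n * f \<in> monomial_span S"
      by (auto simp: localization_def)
    then show "f \<in> ?span"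
      unfolding st_monom_power st_monom_mult_in_span by (auto simp: monomial_span_def)
  qed
  show "?span \<subseteq> ?loc"
  proof
    fix f :: "'a laurent2"
    assume "f \<in> ?span"
    then have "\<forall>p\<in>Poly_Mapping.keys f. \<exists>n::nat. (int n * a, int n * b) + p \<in> S"
      by (auto simp: monomial_span_def)
    then obtain n :: "int \<times> int \<Rightarrow> nat"
      where "\<forall>p\<in>Poly_Mapping.keys f. (int (n p) * a, int (n p) * b) + p \<in> S"
      unfolding bchoice_iff by blast
    then have n: "(int (n p) * a, int (n p) * b) + p \<in> S" if "p \<in> Poly_Mapping.keys f" for p
      using that by blast
    \<comment> \<open>The sum of the exponents is a common denominator exponent.\<close>
    define N where "N = (\<Sum>p\<in>Poly_Mapping.keys f. n p)"
    have "(int N * a, int N * b) + p \<in> S" if p: "p \<in> Poly_Mapping.keys f" for p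
    proof -
      have "n p \<le> N" unfolding N_def using p by (intro member_le_sum) auto
      then have "(int N * a, int N * b) + p
          = (int (N - n p) * a, int (N - n p) * b) + ((int (n p) * a, int (n p) * b) + p)"
        by (cases p) (simp add: algebra_simps of_nat_diff)
      then show ?thesis
        using S(2)[OF semigroup_multiple[OF S u, of "N - n p"] n[OF p]] by (simp only:)
    qed
    then have "st_monom a b ^ N * f \<in> monomial_span S"
      unfolding st_monom_power st_monom_mult_in_span by (auto simp: monomial_span_def)
    then show "f \<in> ?loc"
      unfolding localization_def by blast
  qed
qed


section \<open>Localizations of the curve ring\<close>

text \<open>
  Tracking exponents instead of monomials turns the products in the Cech complex into sums.
\<close>

definition curve_exps :: "nat \<Rightarrow> (int \<times> int) list" where
  "curve_exps r =
     [(2 * int r + 1, 0), (int r + 1, int r), (3, 2 * int r - 2), (2, 2 * int r - 1),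
      (0, 2 * int r + 1)]"

text \<open>
  The group generated by the exponent semigroup.
\<close>

definition curve_lattice :: "nat \<Rightarrow> (int \<times> int) set" where
  "curve_lattice r = {(a, b). 2 * int r + 1 dvd a + b}"

definition s_localized :: "nat \<Rightarrow> (int \<times> int) set" where
  "s_localized r = {(a, b) \<in> curve_lattice r. b \<in> t_semigroup r}"

definition t_localized :: "nat \<Rightarrow> (int \<times> int) set" where
  "t_localized r = {(a, b) \<in> curve_lattice r. a \<ge> 0 \<and> a \<noteq> 1}"

lemma curve_semigroup_lattice: "curve_semigroup r \<subseteq> curve_lattice r"
  by (auto simp: curve_lattice_def elim!: curve_semigroup_degree)

lemma length_curve_gens [simp]: "length (curve_gens r) = 5"
  by (simp add: curve_gens_def)

lemma curve_gens_nth: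
  "l < 5 \<Longrightarrow> curve_gens r ! l = st_monom (fst (curve_exps r ! l)) (snd (curve_exps r ! l))"
  by (auto simp: less_Suc_eq numeral_eq_Suc curve_gens_def curve_exps_def)

lemma curve_gens_prod:
  assumes "I \<subseteq> {..<5}"
  shows "(\<Prod>l\<in>I. curve_gens r ! l)
    = st_monom (\<Sum>l\<in>I. fst (curve_exps r ! l)) (\<Sum>l\<in>I. snd (curve_exps r ! l))"
  unfolding st_monom_prod[symmetric] using assms by (intro prod.cong) (auto simp: curve_gens_nth)

lemma curve_exps_semigroup: "l < 5 \<Longrightarrow> curve_exps r ! l \<in> curve_semigroup r"
proof -
  assume l: "l < 5"
  \<comment> \<open>The semigroup does not depend on the field, so the membership may be read off over any field.\<close>
  have "curve_gens r ! l \<in> (curve_ring r :: rat laurent2 set)"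
    unfolding curve_ring_def subalgebra_generated_def
    using l by (intro hull_inc nth_mem) simp
  then show ?thesis using l by (simp add: curve_gens_nth curve_ring_eq)
qed

lemma curve_exps_sum_semigroup:
  "I \<subseteq> {..<5} \<Longrightarrow> (\<Sum>l\<in>I. curve_exps r ! l) \<in> curve_semigroup r"
proof (induction I rule: infinite_finite_induct)
  case (insert l I)
  then show ?case using curve_semigroup_add[OF curve_exps_semigroup[of l r]] by simp
qed (use curve_semigroup_zero in \<open>simp_all add: zero_prod_def\<close>)

lemma localization_curve_gens_prod:
  assumes "I \<subseteq> {..<5}"
  shows "localization (curve_ring r) (\<Prod>l\<in>I. curve_gens r ! l)
    = monomial_span {(a, b). \<exists>n::nat. (int n * (\<Sum>l\<in>I. fst (curve_exps r ! l)) + a,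
        int n * (\<Sum>l\<in>I. snd (curve_exps r ! l)) + b) \<in> curve_semigroup r}"
proof -
  have "(\<Sum>l\<in>I. fst (curve_exps r ! l), \<Sum>l\<in>I. snd (curve_exps r ! l)) \<in> curve_semigroup r"
    using curve_exps_sum_semigroup[OF assms] by (simp add: sum_prod[symmetric])
  then show ?thesis
    unfolding curve_ring_eq curve_gens_prod[OF assms]
    by (subst localization_monomial_span)
      (auto intro: curve_semigroup_add simp: zero_prod_def curve_semigroup_zero
        intro!: arg_cong[of _ _ monomial_span])
qed

text \<open>
  With \<open>s ^ (2 r + 1)\<close> invertible, the exponent of \<open>s\<close> can be corrected by any multiple of
  \<open>2 r + 1\<close>, so only its residue class matters, which is opposite to that of the exponent of \<open>t\<close>.
\<close>

lemma localization_s: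
  "localization (curve_ring r) (curve_gens r ! 0) = monomial_span (s_localized r)"
proof -
  have "(\<exists>n::nat. (int n * (2 * int r + 1) + a, b) \<in> curve_semigroup r)
      \<longleftrightarrow> (a, b) \<in> s_localized r" for a b
  proof
    assume "\<exists>n::nat. (int n * (2 * int r + 1) + a, b) \<in> curve_semigroup r"
    then obtain n :: nat where n: "(int n * (2 * int r + 1) + a, b) \<in> curve_semigroup r" ..
    then have "2 * int r + 1 dvd int n * (2 * int r + 1) + (a + b)"
      using curve_semigroup_lattice[of r] by (auto simp: curve_lattice_def add.assoc)
    then show "(a, b) \<in> s_localized r"
      using curve_semigroup_snd[OF n]
      by (simp only: s_localized_def curve_lattice_def dvd_add_times_triv_left_iff) simp
  next
    assume ab: "(a, b) \<in> s_localized r"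
    then obtain x1 x2 x3 x4 :: nat where
      b: "b = int r * x1 + (2 * int r - 2) * x2 + (2 * int r - 1) * x3 + (2 * int r + 1) * x4"
      by (auto simp: s_localized_def t_semigroup_def)
    obtain e where e: "a + b = (2 * int r + 1) * e"
      using ab by (auto simp: s_localized_def curve_lattice_def)
    define k where "k = e - (int x1 + x2 + x3 + x4)"
    have a: "a = (2 * int r + 1) * k + (int r + 1) * x1 + 3 * int x2 + 2 * int x3"
      using e b by (simp add: k_def algebra_simps)
    have "int (nat (- k)) * (2 * int r + 1) + a
      = (2 * int r + 1) * int (nat k) + (int r + 1) * x1 + 3 * int x2 + 2 * int x3"
      unfolding a by (cases "k \<ge> 0") (simp_all add: algebra_simps)
    then show "\<exists>n::nat. (int n * (2 * int r + 1) + a, b) \<in> curve_semigroup r"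
      unfolding curve_semigroup_def mem_Collect_eq prod.case using b by blast
  qed
  then show ?thesis
    using localization_curve_gens_prod[of "{0}" r] by (simp add: curve_exps_def)
qed

text \<open>
  Multiplying by a power of \<open>t ^ (2 r + 1)\<close> raises the degree without changing the exponent of
  \<open>s\<close>, so in the end any sum of twos and threes can be reached.
\<close>

lemma localization_t:
  assumes "r \<ge> 1"
  shows "localization (curve_ring r) (curve_gens r ! 4) = monomial_span (t_localized r)"
proof -
  have "(\<exists>n::nat. (a, int n * (2 * int r + 1) + b) \<in> curve_semigroup r)
      \<longleftrightarrow> (a, b) \<in> t_localized r" for a b
  proof
    assume "\<exists>n::nat. (a, int n * (2 * int r + 1) + b) \<in> curve_semigroup r"
    then obtain n :: nat where n: "(a, int n * (2 * int r + 1) + b) \<in> curve_semigroup r" ..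
    then have "2 * int r + 1 dvd int n * (2 * int r + 1) + (a + b)"
      using curve_semigroup_lattice[of r] by (auto simp: curve_lattice_def algebra_simps)
    then show "(a, b) \<in> t_localized r"
      using curve_semigroup_fst[OF n assms]
      by (simp only: t_localized_def curve_lattice_def dvd_add_times_triv_left_iff) simp
  next
    assume ab: "(a, b) \<in> t_localized r"
    then obtain e where e: "a + b = (2 * int r + 1) * e"
      by (auto simp: t_localized_def curve_lattice_def)
    have "(a, int (nat (a - e)) * (2 * int r + 1) + b) \<in> curve_semigroup r"
      using ab e
      by (intro curve_semigroupI[of 0 0 a "e + int (nat (a - e))"])
        (auto simp: t_localized_def algebra_simps)
    then show "\<exists>n::nat. (a, int n * (2 * int r + 1) + b) \<in> curve_semigroup r" ..
  qed
  then show ?thesis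
    using localization_curve_gens_prod[of "{4}" r] by (simp add: curve_exps_def)
qed

lemma curve_exps_sum_pos:
  assumes "r \<ge> 2" "I \<subseteq> {..<5}" "I \<noteq> {}" "I \<noteq> {0}" "I \<noteq> {4}"
  shows "(\<Sum>l\<in>I. fst (curve_exps r ! l)) \<ge> 1" "(\<Sum>l\<in>I. snd (curve_exps r ! l)) \<ge> 1"
proof -
  have fin: "finite I" using assms(2) finite_subset by blast
  have five: "l = 0 \<or> l = 1 \<or> l = 2 \<or> l = 3 \<or> l = 4" if "l \<in> I" for l
  proof -
    have "l < 5" using that assms(2) by auto
    then show ?thesis by linarith
  qed
  have nonneg: "0 \<le> fst (curve_exps r ! l)" "0 \<le> snd (curve_exps r ! l)" if "l \<in> I" for l
    using five[OF that] assms(1) by (auto simp: curve_exps_def)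
  have "\<not> I \<subseteq> {4}" "\<not> I \<subseteq> {0}" using assms(3-5) by (auto dest!: subset_singletonD)
  then obtain l m where "l \<in> I" "l \<noteq> 4" "m \<in> I" "m \<noteq> 0" by auto
  have "fst (curve_exps r ! l) \<ge> 1" using five[of l] \<open>l \<in> I\<close> \<open>l \<noteq> 4\<close> assms(1) by (auto simp: curve_exps_def)
  then show "(\<Sum>l\<in>I. fst (curve_exps r ! l)) \<ge> 1"
    using member_le_sum[of l I "\<lambda>l. fst (curve_exps r ! l)"] nonneg fin \<open>l \<in> I\<close> by fastforce
  have "snd (curve_exps r ! m) \<ge> 1"
    using five[of m] \<open>m \<in> I\<close> \<open>m \<noteq> 0\<close> assms(1) by (auto simp: curve_exps_def)
  then show "(\<Sum>l\<in>I. snd (curve_exps r ! l)) \<ge> 1"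
    using member_le_sum[of m I "\<lambda>l. snd (curve_exps r ! l)"] nonneg fin \<open>m \<in> I\<close> by fastforce
qed

text \<open>
  Far enough inside the quadrant both localizations contain every lattice point, and the degree is
  too large for the exceptional monomials.
\<close>

lemma curve_semigroup_interior:
  assumes r: "r \<ge> 2" and ab: "(a, b) \<in> curve_lattice r" and a: "a \<ge> 2"
    and b: "b > (2 * int r + 1) * ((int r + 1) div 3)"
  shows "(a, b) \<in> curve_semigroup r"
proof -
  obtain n where n: "a + b = (2 * int r + 1) * n" using ab by (auto simp: curve_lattice_def)
  have "(2 * int r + 1) * ((int r + 1) div 3) < (2 * int r + 1) * n" using n a b by linarith
  then have "(int r + 1) div 3 < n" by simp
  then show ?thesis
    using curve_semigroup_saturation[OF r _ _ t_semigroup_conductor[OF r b] n] a by auto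
qed

text \<open>
  The product involves both \<open>s\<close> and \<open>t\<close>, so its powers move every lattice point far into the
  interior of the quadrant.
\<close>

lemma localization_interior:
  assumes r: "r \<ge> 2" and I: "I \<subseteq> {..<5}" "I \<noteq> {}" "I \<noteq> {0}" "I \<noteq> {4}"
  shows "localization (curve_ring r) (\<Prod>l\<in>I. curve_gens r ! l)
    = (monomial_span (curve_lattice r) :: 'k::field laurent2 set)"
proof -
  define u v where "u = (\<Sum>l\<in>I. fst (curve_exps r ! l))" and "v = (\<Sum>l\<in>I. snd (curve_exps r ! l))"
  have uv: "u \<ge> 1" "v \<ge> 1" using curve_exps_sum_pos[OF assms] by (simp_all add: u_def v_def)
  have "(u, v) \<in> curve_lattice r"
    using curve_exps_sum_semigroup[OF I(1), of r] curve_semigroup_lattice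
    by (auto simp: u_def v_def sum_prod[symmetric])
  then have duv: "2 * int r + 1 dvd u + v" by (simp add: curve_lattice_def)
  have lattice: "(int n * u + a, int n * v + b) \<in> curve_lattice r \<longleftrightarrow> (a, b) \<in> curve_lattice r"
    for n a b
  proof -
    have "int n * u + a + (int n * v + b) = int n * (u + v) + (a + b)" by (simp add: algebra_simps)
    then show ?thesis
      using dvd_add_right_iff[OF dvd_mult[OF duv, of "int n"], of "a + b"]
      by (simp only: curve_lattice_def mem_Collect_eq prod.case)
  qed
  have "(\<exists>n::nat. (int n * u + a, int n * v + b) \<in> curve_semigroup r)
      \<longleftrightarrow> (a, b) \<in> curve_lattice r" for a b
  proof
    assume "\<exists>n::nat. (int n * u + a, int n * v + b) \<in> curve_semigroup r"
    then show "(a, b) \<in> curve_lattice r" using lattice subsetD[OF curve_semigroup_lattice] by meson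
  next
    assume ab: "(a, b) \<in> curve_lattice r"
    define c where "c = (2 * int r + 1) * ((int r + 1) div 3)"
    \<comment> \<open>Large enough to bring both exponents above their bounds, as \<open>u\<close> and \<open>v\<close> are positive.\<close>
    define n where "n = nat (\<bar>a\<bar> + \<bar>b\<bar> + c + 2)"
    have "c \<ge> 0" by (simp add: c_def)
    then have n: "int n = \<bar>a\<bar> + \<bar>b\<bar> + c + 2" by (simp add: n_def)
    have "int n * u \<ge> int n" "int n * v \<ge> int n"
      using uv mult_left_mono[of 1 _ "int n"] by simp_all
    then have "int n * u + a \<ge> 2" "int n * v + b > c" using n \<open>c \<ge> 0\<close> by linarith+
    then have "(int n * u + a, int n * v + b) \<in> curve_semigroup r"
      using lattice ab by (intro curve_semigroup_interior[OF r]) (auto simp: c_def)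
    then show "\<exists>n::nat. (int n * u + a, int n * v + b) \<in> curve_semigroup r" ..
  qed
  then show ?thesis
    using localization_curve_gens_prod[OF I(1), of r] by (simp add: u_def v_def)
qed


section \<open>The Cech complex of a subring\<close>

definition is_subring :: "'a::comm_ring_1 set \<Rightarrow> bool" where
  "is_subring R \<longleftrightarrow> 1 \<in> R \<and> (\<forall>x\<in>R. \<forall>y\<in>R. x - y \<in> R \<and> x * y \<in> R)"

lemma subring_zero: "is_subring R \<Longrightarrow> 0 \<in> R"
  unfolding is_subring_def by (metis diff_self)

lemma subring_mult: "is_subring R \<Longrightarrow> x \<in> R \<Longrightarrow> y \<in> R \<Longrightarrow> x * y \<in> R"
  by (simp add: is_subring_def)

lemma subring_diff: "is_subring R \<Longrightarrow> x \<in> R \<Longrightarrow> y \<in> R \<Longrightarrow> x - y \<in> R"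
  by (simp add: is_subring_def)

lemma subring_power: "is_subring R \<Longrightarrow> x \<in> R \<Longrightarrow> x ^ n \<in> R"
  by (induction n) (simp_all add: is_subring_def)

lemma subring_prod: "is_subring R \<Longrightarrow> (\<And>i. i \<in> I \<Longrightarrow> x i \<in> R) \<Longrightarrow> prod x I \<in> R"
  by (induction I rule: infinite_finite_induct) (simp_all add: is_subring_def)

lemma localization_one [simp]: "localization R 1 = R"
  by (auto simp: localization_def)

lemma localization_zero: "is_subring R \<Longrightarrow> 0 \<in> localization R x"
  by (simp add: localization_def subring_zero)

lemma localization_smult:
  assumes "is_subring R" "a \<in> R" "f \<in> localization R x"
  shows "a * f \<in> localization R x"
  using assms subring_mult[OF assms(1,2)] by (auto simp: localization_def mult.left_commute)

lemma localization_diff: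
  assumes R: "is_subring R" "x \<in> R" and "f \<in> localization R x" "g \<in> localization R x"
  shows "f - g \<in> localization R x"
proof -
  obtain m n where mn: "x ^ m * f \<in> R" "x ^ n * g \<in> R"
    using assms(3,4) by (auto simp: localization_def)
  have "x ^ (m + n) * (f - g) = x ^ n * (x ^ m * f) - x ^ m * (x ^ n * g)"
    by (simp add: algebra_simps power_add)
  also have "\<dots> \<in> R" using R mn by (meson subring_diff subring_mult subring_power)
  finally show ?thesis by (auto simp: localization_def)
qed

lemma cech_cochains_zero: "is_subring R \<Longrightarrow> (\<lambda>_. 0) \<in> cech_cochains R xs i"
  by (simp add: cech_cochains_def localization_zero)

lemma cech_cochains_smult:
  "is_subring R \<Longrightarrow> a \<in> R \<Longrightarrow> c \<in> cech_cochains R xs i \<Longrightarrow> (\<lambda>I. a * c I) \<in> cech_cochains R xs i"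
  by (auto simp: cech_cochains_def localization_smult)

lemma cech_cochains_diff:
  assumes R: "is_subring R" "set xs \<subseteq> R"
    and c: "c \<in> cech_cochains R xs i" "c' \<in> cech_cochains R xs i"
  shows "(\<lambda>I. c I - c' I) \<in> cech_cochains R xs i"
proof -
  have "(\<Prod>l\<in>I. xs ! l) \<in> R" if "I \<subseteq> {..<length xs}" for I
    using that R(2) by (intro subring_prod[OF R(1)] subsetD[OF R(2) nth_mem]) auto
  then show ?thesis
    using c localization_diff[OF R(1)] by (auto simp: cech_cochains_def)
qed

lemma cech_d_zero: "cech_d xs (\<lambda>_. 0) = (\<lambda>_. 0)"
  by (auto simp: cech_d_def fun_eq_iff)

lemma cech_d_smult: "cech_d xs (\<lambda>I. a * c I) = (\<lambda>J. a * cech_d xs c J)"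
  by (auto simp: cech_d_def fun_eq_iff sum_distrib_left algebra_simps)

lemma cech_d_diff: "cech_d xs (\<lambda>I. c I - c' I) = (\<lambda>J. cech_d xs c J - cech_d xs c' J)"
  by (auto simp: cech_d_def fun_eq_iff sum_subtractf algebra_simps)

lemma cech_coboundaries_zero: "is_subring R \<Longrightarrow> (\<lambda>_. 0) \<in> cech_coboundaries R xs i"
  by (cases i) (auto intro!: image_eqI[of _ _ "\<lambda>_. 0"] simp: cech_d_zero cech_cochains_zero)

lemma cech_coboundaries_smult:
  assumes "is_subring R" "a \<in> R" "b \<in> cech_coboundaries R xs i"
  shows "(\<lambda>I. a * b I) \<in> cech_coboundaries R xs i"
proof (cases i)
  case (Suc n)
  then show ?thesis
    using assms by (auto simp: cech_d_smult[symmetric] intro!: imageI cech_cochains_smult)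
qed (use assms in simp)

lemma cech_coboundaries_diff:
  assumes "is_subring R" "set xs \<subseteq> R"
    and "b \<in> cech_coboundaries R xs i" "b' \<in> cech_coboundaries R xs i"
  shows "(\<lambda>I. b I - b' I) \<in> cech_coboundaries R xs i"
proof (cases i)
  case (Suc n)
  then show ?thesis
    using assms by (auto simp: cech_d_diff[symmetric] intro!: imageI cech_cochains_diff)
qed (use assms in simp)

lemma cech_coboundaries_add:
  assumes "is_subring R" "set xs \<subseteq> R"
    and "b \<in> cech_coboundaries R xs i" "b' \<in> cech_coboundaries R xs i"
  shows "(\<lambda>I. b I + b' I) \<in> cech_coboundaries R xs i"
  using cech_coboundaries_diff[OF assms(1,2,3)
      cech_coboundaries_diff[OF assms(1,2) cech_coboundaries_zero[OF assms(1)] assms(4)]]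
  by simp

lemma mem_cech_class:
  "w \<in> cech_class R xs i z \<longleftrightarrow> (\<lambda>I. w I - z I) \<in> cech_coboundaries R xs i"
  by (auto simp: cech_class_def intro!: exI[of _ "\<lambda>I. w I - z I"])

lemma cech_class_eq_coboundaries_iff:
  assumes R: "is_subring R" "set xs \<subseteq> R"
  shows "cech_class R xs i z = cech_coboundaries R xs i \<longleftrightarrow> z \<in> cech_coboundaries R xs i"
proof
  assume "cech_class R xs i z = cech_coboundaries R xs i"
  moreover have "z \<in> cech_class R xs i z"
    by (simp add: mem_cech_class cech_coboundaries_zero R)
  ultimately show "z \<in> cech_coboundaries R xs i" by simp
next
  assume z: "z \<in> cech_coboundaries R xs i"
  have "w \<in> cech_coboundaries R xs i" if "(\<lambda>I. w I - z I) \<in> cech_coboundaries R xs i" for w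
    using cech_coboundaries_add[OF R that z] by simp
  then show "cech_class R xs i z = cech_coboundaries R xs i"
    using cech_coboundaries_diff[OF R _ z] by (auto simp: mem_cech_class)
qed

lemma annihilates_lc_iff:
  assumes R: "is_subring R" "set xs \<subseteq> R" and "I \<subseteq> R"
  shows "annihilates_lc R xs I i \<longleftrightarrow>
    (\<forall>a\<in>I. \<forall>z\<in>cech_cocycles R xs i. (\<lambda>J. a * z J) \<in> cech_coboundaries R xs i)"
proof -
  have "lc_smult R xs i a (cech_class R xs i z) = cech_coboundaries R xs i \<longleftrightarrow>
      (\<lambda>J. a * z J) \<in> cech_coboundaries R xs i" (is "?L \<longleftrightarrow> ?R") if a: "a \<in> R" for a z
  proof
    have z: "z \<in> cech_class R xs i z"
      by (simp add: mem_cech_class cech_coboundaries_zero R)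
    {
      assume ?L
      moreover have "(\<lambda>J. a * z J) \<in> cech_class R xs i (\<lambda>J. a * z J)"
        by (simp add: mem_cech_class cech_coboundaries_zero R)
      ultimately show ?R using z unfolding lc_smult_def by blast
    }
    {
      assume az: ?R
      have "cech_class R xs i (\<lambda>J. a * w J) = cech_coboundaries R xs i"
        if "w \<in> cech_class R xs i z" for w
      proof -
        have "(\<lambda>J. a * (w J - z J) + a * z J) \<in> cech_coboundaries R xs i"
          using that az a R cech_coboundaries_smult[OF R(1) a, of "\<lambda>J. w J - z J"]
          by (intro cech_coboundaries_add) (auto simp: mem_cech_class)
        then show ?thesis
          unfolding cech_class_eq_coboundaries_iff[OF R] by (simp add: algebra_simps)
      qed
      then show ?L using z unfolding lc_smult_def by blast
    }
  qed
  then have "(\<forall>z\<in>cech_cocycles R xs i. lc_smult R xs i a (cech_class R xs i z) = cech_coboundaries R xs i)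
      \<longleftrightarrow> (\<forall>z\<in>cech_cocycles R xs i. (\<lambda>J. a * z J) \<in> cech_coboundaries R xs i)" if "a \<in> I" for a
    using that \<open>I \<subseteq> R\<close> by blast
  then show ?thesis unfolding annihilates_lc_def local_cohomology_def by simp
qed

lemma local_cohomology_deg_trivial_iff:
  assumes R: "is_subring R" "set xs \<subseteq> R" and L: "0 \<in> L j"
  shows "local_cohomology_deg L R xs i j = {cech_coboundaries R xs i} \<longleftrightarrow>
    (\<forall>z\<in>cech_cocycles R xs i. (\<forall>I. z I \<in> L j) \<longrightarrow> z \<in> cech_coboundaries R xs i)"
proof -
  have "(\<lambda>_. 0) \<in> {z \<in> cech_cocycles R xs i. \<forall>I. z I \<in> L j}"
    using R L by (simp add: cech_cocycles_def cech_d_zero cech_cochains_zero)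
  then have "local_cohomology_deg L R xs i j \<noteq> {}"
    unfolding local_cohomology_deg_def by blast
  then have "local_cohomology_deg L R xs i j = {cech_coboundaries R xs i} \<longleftrightarrow>
      (\<forall>z\<in>{z \<in> cech_cocycles R xs i. \<forall>I. z I \<in> L j}.
        cech_class R xs i z = cech_coboundaries R xs i)"
    unfolding local_cohomology_deg_def by blast
  then show ?thesis by (auto simp: cech_class_eq_coboundaries_iff[OF R])
qed

lemma cech_d_singleton: "l < length xs \<Longrightarrow> cech_d xs c {l} = c {}"
  by (simp add: cech_d_def Collect_conv_if)

lemma cech_d_pair:
  assumes "l < m" "m < length xs"
  shows "cech_d xs c {l, m} = c {m} - c {l}"
proof -
  have sets: "{k \<in> {l, m}. k < l} = {}" "{k \<in> {l, m}. k < m} = {l}"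
    "{l, m} - {l} = {m}" "{l, m} - {m} = {l}"
    using assms by auto
  have "cech_d xs c {l, m} = (\<Sum>k\<in>{l, m}. (-1) ^ card {j \<in> {l, m}. j < k} * c ({l, m} - {k}))"
    using assms by (simp add: cech_d_def)
  also have "\<dots> = (-1) ^ card {j \<in> {l, m}. j < l} * c ({l, m} - {l})
      + (-1) ^ card {j \<in> {l, m}. j < m} * c ({l, m} - {m})"
    using assms by (subst sum.insert) auto
  finally show ?thesis unfolding sets by simp
qed

lemma cech_d_other_card:
  assumes "\<And>I. card I \<noteq> i \<Longrightarrow> c I = 0" "card J \<noteq> Suc i"
  shows "cech_d xs c J = 0"
proof -
  have "c (J - {l}) = 0" if "J \<subseteq> {..<length xs}" "l \<in> J" for l
  proof (rule assms(1))
    have "finite J" using that(1) finite_subset by blast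
    then have "Suc (card (J - {l})) = card J" using that(2) by (rule card_Suc_Diff1)
    then show "card (J - {l}) \<noteq> i" using assms(2) by simp
  qed
  then show ?thesis by (simp add: cech_d_def)
qed

definition cech_const :: "'a::comm_ring_1 list \<Rightarrow> 'a \<Rightarrow> nat set \<Rightarrow> 'a" where
  "cech_const xs f I = (if \<exists>l<length xs. I = {l} then f else 0)"

lemma cech_d_const: "cech_d xs (cech_const xs f) = (\<lambda>_. 0)"
proof
  fix J
  show "cech_d xs (cech_const xs f) J = 0"
  proof (cases "card J = 2 \<and> J \<subseteq> {..<length xs}")
    case True
    then obtain l m where "J = {l, m}" "l \<noteq> m" by (auto simp: card_2_iff)
    then obtain l m where lm: "J = {l, m}" "l < m" by (metis insert_commute nat_neq_iff)
    then show ?thesis using True by (auto simp: cech_d_pair cech_const_def)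
  next
    case False
    then show ?thesis
    proof (cases "J \<subseteq> {..<length xs}")
      case True
      with False show ?thesis
        by (intro cech_d_other_card[of 1]) (auto simp: cech_const_def)
    qed (simp add: cech_d_def)
  qed
qed

text \<open>
  A 1-cocycle has equal values at any two indices, hence is a single element that lies in all
  localizations.
\<close>

lemma cech_cocycles_1_iff:
  assumes "xs \<noteq> []"
  shows "z \<in> cech_cocycles R xs 1 \<longleftrightarrow>
    (\<exists>f. z = cech_const xs f \<and> (\<forall>l<length xs. f \<in> localization R (xs ! l)))"
proof
  assume z: "z \<in> cech_cocycles R xs 1"
  have const: "z {l} = z {0}" if "l < length xs" for l
  proof (cases "l = 0")
    case False
    then have "cech_d xs z {0, l} = z {l} - z {0}" using that by (intro cech_d_pair) auto
    then show ?thesis using z by (simp add: cech_cocycles_def)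
  qed simp
  have loc: "if I \<subseteq> {..<length xs} \<and> card I = 1
      then z I \<in> localization R (\<Prod>l\<in>I. xs ! l) else z I = 0" for I
    using z unfolding cech_cocycles_def cech_cochains_def by blast
  have "z = cech_const xs (z {0})"
  proof
    fix I
    show "z I = cech_const xs (z {0}) I"
    proof (cases "\<exists>l<length xs. I = {l}")
      case True
      then show ?thesis using const by (auto simp: cech_const_def)
    next
      case False
      then have "\<not> (I \<subseteq> {..<length xs} \<and> card I = 1)" by (auto simp: card_1_singleton_iff)
      then have "z I = 0" using loc[of I] by argo
      then show ?thesis using False unfolding cech_const_def by argo
    qed
  qed
  moreover have "z {0} \<in> localization R (xs ! l)" if "l < length xs" for l
    using loc[of "{l}"] that const[OF that] by simp
  ultimately show "\<exists>f. z = cech_const xs f \<and> (\<forall>l<length xs. f \<in> localization R (xs ! l))"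
    by blast
next
  assume "\<exists>f. z = cech_const xs f \<and> (\<forall>l<length xs. f \<in> localization R (xs ! l))"
  then show "z \<in> cech_cocycles R xs 1"
    by (auto simp: cech_cocycles_def cech_d_const cech_cochains_def cech_const_def
        card_1_singleton_iff split: if_splits)
qed

lemma cech_const_coboundary_iff:
  assumes "xs \<noteq> []"
  shows "cech_const xs f \<in> cech_coboundaries R xs 1 \<longleftrightarrow> f \<in> R"
proof
  assume "cech_const xs f \<in> cech_coboundaries R xs 1"
  then obtain c where c: "c \<in> cech_cochains R xs 0" "cech_const xs f = cech_d xs c" by auto
  have "f = cech_d xs c {0}" using assms by (simp add: c(2)[symmetric] cech_const_def)
  also have "\<dots> = c {}" using assms by (intro cech_d_singleton) simp
  also have "\<dots> \<in> R"
    using c(1)[unfolded cech_cochains_def mem_Collect_eq, rule_format, of "{}"] by simp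
  finally show "f \<in> R" .
next
  assume f: "f \<in> R"
  define c where "c I = (if I = {} then f else 0)" for I :: "nat set"
  have "cech_d xs c J = cech_const xs f J" for J
  proof (cases "J \<subseteq> {..<length xs} \<and> card J = 1")
    case True
    then show ?thesis
      by (auto simp: card_1_singleton_iff cech_d_singleton cech_const_def c_def)
  next
    case False
    then have "\<not> (\<exists>l<length xs. J = {l})" by auto
    moreover have "cech_d xs c J = 0"
    proof (cases "J \<subseteq> {..<length xs}")
      case True
      have "J - {l} \<noteq> {}" if "l \<in> J" for l
      proof
        assume "J - {l} = {}"
        then have "J = {l}" using that by blast
        then show False using True False by simp
      qed
      then show ?thesis by (simp add: cech_d_def c_def)
    qed (simp add: cech_d_def)
    ultimately show ?thesis unfolding cech_const_def by argo
  qed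
  moreover have "c \<in> cech_cochains R xs 0"
    using f finite_subset[of _ "{..<length xs}"] by (auto simp: cech_cochains_def c_def)
  ultimately have "cech_d xs c \<in> cech_coboundaries R xs 1" "cech_d xs c = cech_const xs f"
    by auto
  then show "cech_const xs f \<in> cech_coboundaries R xs 1" by (simp only:)
qed

text \<open>
  By the descriptions of cocycles and coboundaries above, \<open>H\<^sup>1\<close> is the intersection of the
  localizations modulo the ring.
\<close>

lemma annihilates_lc_1_iff:
  assumes R: "is_subring R" "set xs \<subseteq> R" "I \<subseteq> R" and xs: "xs \<noteq> []"
  shows "annihilates_lc R xs I 1 \<longleftrightarrow>
    (\<forall>a\<in>I. \<forall>f. (\<forall>l<length xs. f \<in> localization R (xs ! l)) \<longrightarrow> a * f \<in> R)"
proof -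
  have "(\<lambda>J. a * cech_const xs f J) = cech_const xs (a * f)" for a f
    by (auto simp: cech_const_def fun_eq_iff)
  then have scaled: "(\<lambda>J. a * cech_const xs f J) \<in> cech_coboundaries R xs 1 \<longleftrightarrow> a * f \<in> R" for a f
    using cech_const_coboundary_iff[OF xs] by simp
  show ?thesis
    unfolding annihilates_lc_iff[OF R]
  proof (intro iffI ballI allI impI)
    fix a f
    assume H: "\<forall>a\<in>I. \<forall>z\<in>cech_cocycles R xs 1. (\<lambda>J. a * z J) \<in> cech_coboundaries R xs 1"
      and a: "a \<in> I" and "\<forall>l<length xs. f \<in> localization R (xs ! l)"
    then have "cech_const xs f \<in> cech_cocycles R xs 1"
      unfolding cech_cocycles_1_iff[OF xs] by iprover
    from bspec[OF bspec[OF H a] this] show "a * f \<in> R" unfolding scaled .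
  next
    fix a z
    assume H: "\<forall>a\<in>I. \<forall>f. (\<forall>l<length xs. f \<in> localization R (xs ! l)) \<longrightarrow> a * f \<in> R"
      and a: "a \<in> I" and "z \<in> cech_cocycles R xs 1"
    then obtain f where z: "z = cech_const xs f" and f: "\<forall>l<length xs. f \<in> localization R (xs ! l)"
      unfolding cech_cocycles_1_iff[OF xs] by iprover
    from H[THEN bspec, OF a, THEN spec, THEN mp, OF f] have "a * f \<in> R" .
    then show "(\<lambda>J. a * z J) \<in> cech_coboundaries R xs 1" unfolding z scaled .
  qed
qed

lemma cech_cocycles_0:
  assumes "xs \<noteq> []" "z \<in> cech_cocycles R xs 0"
  shows "z \<in> cech_coboundaries R xs 0"
proof -
  have "cech_d xs z {0} = z {}" using assms(1) by (simp add: cech_d_singleton)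
  then have zero: "z {} = 0" using assms(2) by (simp add: cech_cocycles_def)
  have "z I = 0" for I
  proof (cases "I = {}")
    case True
    then show ?thesis using zero by simp
  next
    case False
    then have "\<not> (I \<subseteq> {..<length xs} \<and> card I = 0)"
      using finite_subset[of I "{..<length xs}"] by auto
    moreover have "if I \<subseteq> {..<length xs} \<and> card I = 0
        then z I \<in> localization R (\<Prod>l\<in>I. xs ! l) else z I = 0"
      using assms(2) unfolding cech_cocycles_def cech_cochains_def by blast
    ultimately show ?thesis by argo
  qed
  then show ?thesis by (simp add: fun_eq_iff)
qed

text \<open>
  The standard contracting homotopy of the Cech complex in which all localizations are replaced by
  the ambient ring. Using the index \<open>0\<close>, the smallest one, avoids signs.
\<close>

definition cech_contraction :: "(nat set \<Rightarrow> 'a::comm_ring_1) \<Rightarrow> nat set \<Rightarrow> 'a" where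
  "cech_contraction z I = (if 0 \<in> I then 0 else z (insert 0 I))"

text \<open>
  For \<open>0 \<in> J\<close> only the face opposite to \<open>0\<close> survives. For \<open>0 \<notin> J\<close> the sum is, up to sign, that
  of the cocycle condition at \<open>insert 0 J\<close> without the term \<open>z J\<close>.
\<close>

lemma cech_d_contraction:
  assumes "xs \<noteq> []" "z \<in> cech_cocycles R xs i"
  shows "cech_d xs (cech_contraction z) = z"
proof
  fix J
  have dz: "cech_d xs z J' = 0" for J' using assms(2) by (simp add: cech_cocycles_def)
  show "cech_d xs (cech_contraction z) J = z J"
  proof (cases "J \<subseteq> {..<length xs}")
    case False
    moreover have "if J \<subseteq> {..<length xs} \<and> card J = i
        then z J \<in> localization R (\<Prod>l\<in>J. xs ! l) else z J = 0"
      using assms(2) unfolding cech_cocycles_def cech_cochains_def by blast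
    ultimately have "z J = 0" by argo
    with False show ?thesis by (simp add: cech_d_def)
  next
    case True
    then have fin: "finite J" using finite_subset by blast
    let ?term = "\<lambda>l. (-1) ^ card {m \<in> J. m < l} * cech_contraction z (J - {l})"
    show ?thesis
    proof (cases "0 \<in> J")
      case zero: True
      have "(\<Sum>l\<in>J. ?term l) = (\<Sum>l\<in>{0}. ?term l)"
        using zero fin by (intro sum.mono_neutral_right) (auto simp: cech_contraction_def)
      then show ?thesis using True zero
        by (simp add: cech_d_def cech_contraction_def insert_absorb)
    next
      case zero: False
      have sign: "card {m \<in> insert 0 J. m < l} = Suc (card {m \<in> J. m < l})" if "l \<in> J" for l
      proof -
        have "{m \<in> insert 0 J. m < l} = insert 0 {m \<in> J. m < l}"
          using that zero by (auto intro: gr0I)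
        then show ?thesis using zero fin by simp
      qed
      have face: "insert 0 J - {l} = insert 0 (J - {l})" if "l \<in> J" for l
        using that zero by auto
      have "0 = cech_d xs z (insert 0 J)" by (simp add: dz)
      also have "\<dots> = z J + (\<Sum>l\<in>J. (-1) ^ card {m \<in> insert 0 J. m < l} * z (insert 0 J - {l}))"
        using True assms(1) zero fin by (simp add: cech_d_def)
      also have "(\<Sum>l\<in>J. (-1) ^ card {m \<in> insert 0 J. m < l} * z (insert 0 J - {l}))
          = (\<Sum>l\<in>J. - ?term l)"
      proof (rule sum.cong[OF refl])
        fix l assume "l \<in> J"
        then show "(-1) ^ card {m \<in> insert 0 J. m < l} * z (insert 0 J - {l}) = - ?term l"
          unfolding sign[OF \<open>l \<in> J\<close>] face[OF \<open>l \<in> J\<close>] using zero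
          by (simp add: cech_contraction_def)
      qed
      finally show ?thesis using True by (simp add: cech_d_def sum_negf)
    qed
  qed
qed

text \<open>
  The contraction provides a primitive as soon as its values lie in the right localizations.
\<close>

lemma cech_coboundariesI:
  assumes z: "z \<in> cech_cocycles R xs (Suc i)" and R: "is_subring R" and "xs \<noteq> []"
    and loc: "\<And>I. I \<subseteq> {..<length xs} \<Longrightarrow> card I = i \<Longrightarrow> 0 \<notin> I \<Longrightarrow>
      localization R (\<Prod>l\<in>insert 0 I. xs ! l) \<subseteq> localization R (\<Prod>l\<in>I. xs ! l)"
  shows "z \<in> cech_coboundaries R xs (Suc i)"
proof -
  have "cech_contraction z \<in> cech_cochains R xs i"
    unfolding cech_cochains_def mem_Collect_eq
  proof
    fix I
    have zI: "if insert 0 I \<subseteq> {..<length xs} \<and> card (insert 0 I) = Suc i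
      then z (insert 0 I) \<in> localization R (\<Prod>l\<in>insert 0 I. xs ! l) else z (insert 0 I) = 0"
      using z unfolding cech_cocycles_def cech_cochains_def by blast
    show "if I \<subseteq> {..<length xs} \<and> card I = i
      then cech_contraction z I \<in> localization R (\<Prod>l\<in>I. xs ! l) else cech_contraction z I = 0"
    proof (cases "0 \<in> I")
      case True
      then show ?thesis by (simp add: cech_contraction_def localization_zero R)
    next
      case False
      have "insert 0 I \<subseteq> {..<length xs} \<longleftrightarrow> I \<subseteq> {..<length xs}" using \<open>xs \<noteq> []\<close> by auto
      moreover have "card (insert 0 I) = Suc (card I)" if "I \<subseteq> {..<length xs}"
        using that False finite_subset by (intro card_insert_disjoint) auto
      ultimately show ?thesis
        using False zI loc[of I] by (auto simp: cech_contraction_def split: if_splits)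
    qed
  qed
  moreover have "z = cech_d xs (cech_contraction z)"
    using cech_d_contraction[OF \<open>xs \<noteq> []\<close> z] ..
  ultimately show ?thesis by auto
qed


section \<open>Annihilators of the first local cohomology\<close>

definition curve_saturation :: "nat \<Rightarrow> (int \<times> int) set" where
  "curve_saturation r = s_localized r \<inter> t_localized r"

lemma mem_curve_saturation:
  "(a, b) \<in> curve_saturation r \<longleftrightarrow>
    2 * int r + 1 dvd a + b \<and> a \<ge> 0 \<and> a \<noteq> 1 \<and> b \<in> t_semigroup r"
  by (auto simp: curve_saturation_def s_localized_def t_localized_def curve_lattice_def)

lemma curve_saturation_cases:
  assumes "r \<ge> 2" "(a, b) \<in> curve_saturation r" "(a, b) \<notin> curve_semigroup r"
  obtains n where "a = int r + 2" "a + b = (2 * int r + 1) * n" "2 \<le> n" "n \<le> (int r + 1) div 3"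
proof -
  obtain n where "a + b = (2 * int r + 1) * n"
    using assms(2) by (auto simp: mem_curve_saturation)
  with curve_semigroup_saturation[OF assms(1) _ _ _ this] assms(2,3) that show thesis
    by (auto simp: mem_curve_saturation)
qed

text \<open>
  The exponent of \<open>t\<close> is \<open>3 r + (n - 2) (2 r + 1)\<close>.
\<close>

lemma gap_in_curve_saturation:
  assumes "n \<ge> 2"
  shows "(int r + 2, (2 * int r + 1) * n - (int r + 2)) \<in> curve_saturation r"
proof -
  have "(2 * int r + 1) * n - (int r + 2) \<in> t_semigroup r"
    using assms by (intro t_semigroup_interval[of "n - 2" 3]) (auto simp: algebra_simps)
  then show ?thesis by (simp add: mem_curve_saturation)
qed

lemma curve_ring_subring: "is_subring (curve_ring r :: 'k::field laurent2 set)"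
  unfolding is_subring_def curve_ring_eq
proof (intro conjI ballI)
  show "1 \<in> (monomial_span (curve_semigroup r) :: 'k laurent2 set)"
    using curve_semigroup_zero[of r] by (simp flip: st_monom_zero)
qed (auto intro: monomial_span_diff monomial_span_mult curve_semigroup_add)

lemma curve_gens_subset: "set (curve_gens r) \<subseteq> curve_ring r"
  unfolding curve_ring_def subalgebra_generated_def by (rule hull_subset)

lemma curve_gens_not_Nil: "curve_gens r \<noteq> []"
  by (simp add: curve_gens_def)

lemma s_localized_subset: "s_localized r \<subseteq> curve_lattice r"
  by (auto simp: s_localized_def)

lemma localization_gen:
  assumes "r \<ge> 2" "l < 5"
  shows "localization (curve_ring r) (curve_gens r ! l)
    = (monomial_span (if l = 0 then s_localized r else if l = 4 then t_localized r else curve_lattice r)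
       :: 'k::field laurent2 set)"
proof -
  consider "l = 0" | "l = 4" | "l \<noteq> 0" "l \<noteq> 4" by blast
  then show ?thesis
  proof cases
    case 3
    then show ?thesis
      using localization_interior[OF assms(1), of "{l}", where 'k = 'k] assms(2) by simp
  qed (use assms in \<open>simp_all add: localization_s localization_t\<close>)
qed

text \<open>
  Only the two extreme generators impose a condition.
\<close>

lemma localization_gens_iff:
  assumes "r \<ge> 2"
  shows "(\<forall>l<length (curve_gens r). f \<in> localization (curve_ring r) (curve_gens r ! l))
    \<longleftrightarrow> (f :: 'k::field laurent2) \<in> monomial_span (curve_saturation r)"
proof -
  have "(\<forall>l<5. f \<in> localization (curve_ring r) (curve_gens r ! l))
      \<longleftrightarrow> f \<in> monomial_span (s_localized r) \<and> f \<in> monomial_span (t_localized r)" (is "?L \<longleftrightarrow> ?R")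
  proof
    assume L: ?L
    from L[rule_format, of 0] L[rule_format, of 4] show ?R
      by (simp add: localization_gen assms)
  next
    assume ?R
    then show ?L
      using monomial_span_mono[OF s_localized_subset, of r] by (auto simp: localization_gen assms)
  qed
  then show ?thesis unfolding curve_saturation_def monomial_span_Int by simp
qed

lemma power_in_ideal_pow:
  assumes "1 \<in> R" "x \<in> X"
  shows "x ^ k \<in> ideal_pow R (ideal_generated R X) k"
proof (induction k)
  case (Suc k)
  have "x \<in> ideal_generated R X" unfolding ideal_generated_def by (rule hull_inc[OF assms(2)])
  with Suc have "x ^ k * x \<in> ideal_pow R (ideal_generated R X) (Suc k)"
    unfolding ideal_pow.simps ideal_generated_def[of R "{f * g |f g. _ f g}"] by (intro hull_inc) blast
  then show ?case by (simp add: mult.commute)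
qed (use assms(1) in simp)

lemma ideal_pow_degree:
  "ideal_pow (curve_ring r) (ideal_generated (curve_ring r) (set (curve_gens r))) k
    \<subseteq> (monomial_span {(a, b) \<in> curve_semigroup r. a + b \<ge> (2 * int r + 1) * int k}
       :: 'k::field laurent2 set)"
proof -
  define T where "T k = {(a, b) \<in> curve_semigroup r. a + b \<ge> (2 * int r + 1) * int k}" for k :: nat
  let ?R = "curve_ring r :: 'k laurent2 set"
  have T_add: "p + q \<in> T (i + j)" if "p \<in> T i" "q \<in> T j" for p q i j
    using that curve_semigroup_add[of p r q] by (cases p; cases q) (auto simp: T_def algebra_simps)
  have S: "curve_semigroup r = T 0"
    by (auto simp: T_def elim: curve_semigroup_degree)
  have T_sub: "T k \<subseteq> curve_semigroup r" for k by (auto simp: T_def)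
  have ideal: "is_ideal_of ?R (monomial_span (T k))" for k
    unfolding is_ideal_of_def curve_ring_eq
  proof (intro conjI ballI monomial_span_mono T_sub monomial_span_zero)
    fix a f :: "'k laurent2"
    assume "a \<in> monomial_span (curve_semigroup r)" "f \<in> monomial_span (T k)"
    then show "a * f \<in> monomial_span (T k)"
      by (rule monomial_span_mult) (use T_add[of _ 0 _ k] S in simp)
  qed (rule monomial_span_add)
  have "set (curve_gens r) \<subseteq> (monomial_span (T 1) :: 'k laurent2 set)"
  proof
    fix x :: "'k laurent2" assume x: "x \<in> set (curve_gens r)"
    have "x \<in> monomial_span (curve_semigroup r)" "x \<in> curve_grading r 1"
      using x curve_gens_subset curve_gens_degree by (auto simp: curve_ring_eq[symmetric])
    then show "x \<in> monomial_span (T 1)"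
      by (force simp: monomial_span_def curve_grading_def T_def)
  qed
  then have m: "ideal_generated ?R (set (curve_gens r)) \<subseteq> monomial_span (T 1)"
    unfolding ideal_generated_def by (rule hull_minimal) (rule ideal)
  have "ideal_pow ?R (ideal_generated ?R (set (curve_gens r))) k \<subseteq> monomial_span (T k)"
  proof (induction k)
    case 0
    show ?case using S by (simp add: curve_ring_eq)
  next
    case (Suc k)
    show ?case
      unfolding ideal_pow.simps ideal_generated_def[of ?R "{f * g |f g. _ f g}"]
    proof (rule hull_minimal[where S = "is_ideal_of ?R", OF _ ideal])
      show "{f * g |f g. f \<in> ideal_pow ?R (ideal_generated ?R (set (curve_gens r))) k
          \<and> g \<in> ideal_generated ?R (set (curve_gens r))} \<subseteq> monomial_span (T (Suc k))"
      proof clarify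
        fix f g assume "f \<in> ideal_pow ?R (ideal_generated ?R (set (curve_gens r))) k"
          "g \<in> ideal_generated ?R (set (curve_gens r))"
        then have "f \<in> monomial_span (T k)" "g \<in> monomial_span (T 1)" using Suc m by auto
        then show "f * g \<in> monomial_span (T (Suc k))"
          by (rule monomial_span_mult) (use T_add[of _ k _ 1] in simp)
      qed
    qed
  qed
  then show ?thesis by (simp add: T_def)
qed

text \<open>
  Multiplying \<open>H\<^sup>1\<close>, which lives in the degrees \<open>2, \<dots>, \<lfloor>(r + 1) / 3\<rfloor>\<close>, by forms of degree \<open>k\<close> lands
  in degrees \<open>\<ge> k + 2\<close>. Conversely, multiplication by a power of \<open>t ^ (2 r + 1)\<close> maps the monomial
  of degree \<open>2\<close> to those of higher degree with the same exponent of \<open>s\<close>.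
\<close>

lemma curve_annihilates_lc_iff:
  assumes r: "r \<ge> 2"
  shows "annihilates_lc (curve_ring r :: 'k::field laurent2 set) (curve_gens r)
      (ideal_pow (curve_ring r) (ideal_generated (curve_ring r) (set (curve_gens r))) k) 1
    \<longleftrightarrow> (int r + 1) div 3 \<le> int k + 1"
proof -
  define q where "q = (int r + 1) div 3"
  let ?R = "curve_ring r :: 'k laurent2 set"
  let ?I = "ideal_pow ?R (ideal_generated ?R (set (curve_gens r))) k"
  have "?I \<subseteq> ?R"
    unfolding curve_ring_eq using ideal_pow_degree[of r k, where 'k = 'k]
    by (force simp: curve_ring_eq monomial_span_def)
  note ann = annihilates_lc_1_iff[OF curve_ring_subring curve_gens_subset this curve_gens_not_Nil,
      unfolded localization_gens_iff[OF r]]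
  have "(\<forall>a\<in>?I. \<forall>f. f \<in> monomial_span (curve_saturation r) \<longrightarrow> a * f \<in> ?R) \<longleftrightarrow> q \<le> int k + 1"
  proof
    assume *: "\<forall>a\<in>?I. \<forall>f. f \<in> monomial_span (curve_saturation r) \<longrightarrow> a * f \<in> ?R"
    show "q \<le> int k + 1"
    proof (rule ccontr)
      assume "\<not> q \<le> int k + 1"
      then have n: "3 * (int k + 2) \<le> int r + 1" unfolding q_def by presburger
      let ?t = "st_monom 0 (2 * int r + 1) :: 'k laurent2"
      let ?g = "st_monom (int r + 2) ((2 * int r + 1) * 2 - (int r + 2)) :: 'k laurent2"
      have "?t ^ k \<in> ?I"
        using curve_ring_subring[of r, where 'k = 'k]
        by (intro power_in_ideal_pow) (simp_all add: curve_gens_def is_subring_def)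
      moreover have "?g \<in> monomial_span (curve_saturation r)"
        using gap_in_curve_saturation[of 2 r] by simp
      ultimately have "?t ^ k * ?g \<in> ?R" using * by blast
      then have "(int r + 2, int k * (2 * int r + 1) + ((2 * int r + 1) * 2 - (int r + 2)))
          \<in> curve_semigroup r"
        unfolding st_monom_power st_monom_mult curve_ring_eq st_monom_in_span by simp
      moreover have "(int r + 2, int k * (2 * int r + 1) + ((2 * int r + 1) * 2 - (int r + 2)))
          \<notin> curve_semigroup r"
        using n r by (intro curve_semigroup_gap[of "int k + 2"]) (auto simp: algebra_simps)
      ultimately show False by contradiction
    qed
  next
    assume q: "q \<le> int k + 1"
    show "\<forall>a\<in>?I. \<forall>f. f \<in> monomial_span (curve_saturation r) \<longrightarrow> a * f \<in> ?R"
    proof (intro ballI allI impI)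
      fix g f :: "'k laurent2" assume "g \<in> ?I" and f: "f \<in> monomial_span (curve_saturation r)"
      then have g: "g \<in> monomial_span {(a, b) \<in> curve_semigroup r. a + b \<ge> (2 * int r + 1) * int k}"
        using ideal_pow_degree[of r k, where 'k = 'k] by blast
      show "g * f \<in> ?R"
        unfolding curve_ring_eq
      proof (rule monomial_span_mult[OF g f], clarify)
        fix a b a' b'
        assume ab: "(a, b) \<in> curve_semigroup r" "(2 * int r + 1) * int k \<le> a + b"
          and ab': "(a', b') \<in> curve_saturation r"
        have sat: "(a + a', b + b') \<in> curve_saturation r" if "a' = int r + 2"
        proof -
          have b': "b' \<in> t_semigroup r" and dvd': "2 * int r + 1 dvd a' + b'"
            using ab' by (simp_all add: mem_curve_saturation)
          have "2 * int r + 1 dvd a + b"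
            using subsetD[OF curve_semigroup_lattice ab(1)] by (simp add: curve_lattice_def)
          then have "2 * int r + 1 dvd a + a' + (b + b')"
            using dvd_add[OF _ dvd'] by (metis add.assoc add.left_commute)
          moreover have "a \<ge> 0" using curve_semigroup_fst[OF ab(1)] r by simp
          ultimately show ?thesis
            using that r t_semigroup_add[OF curve_semigroup_snd[OF ab(1)] b']
            unfolding mem_curve_saturation by linarith
        qed
        show "(a, b) + (a', b') \<in> curve_semigroup r"
        proof (cases "(a', b') \<in> curve_semigroup r")
          case True
          then show ?thesis using curve_semigroup_add ab(1) by blast
        next
          case False
          then obtain n' where n': "a' = int r + 2" "a' + b' = (2 * int r + 1) * n'" "2 \<le> n'"
            by (rule curve_saturation_cases[OF r ab'])
          show ?thesis
          proof (rule ccontr)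
            assume "(a, b) + (a', b') \<notin> curve_semigroup r"
            then have "(a + a', b + b') \<notin> curve_semigroup r" by simp
            then obtain n where n: "a + a' + (b + b') = (2 * int r + 1) * n" "n \<le> q"
              unfolding q_def by (rule curve_saturation_cases[OF r sat[OF n'(1)]])
            have "(2 * int r + 1) * (int k + 2) \<le> (2 * int r + 1) * (int k + n')"
              using n'(3) by (intro mult_left_mono) auto
            also have "\<dots> \<le> (2 * int r + 1) * n" using n(1) n'(2) ab(2) by (simp add: algebra_simps)
            finally have "int k + 2 \<le> n" by (simp add: mult_le_cancel_left)
            then show False using n(2) q by simp
          qed
        qed
      qed
    qed
  qed
  then show ?thesis unfolding ann q_def .
qed


section \<open>Vanishing and nonvanishing in each degree\<close>

lemma curve_grading_eq: "curve_grading r j = monomial_span {(a, b). a + b = (2 * int r + 1) * j}"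
  by (auto simp: curve_grading_def monomial_span_def)

lemma curve_H1_vanishing:
  assumes r: "r \<ge> 2" and j: "j > (int r + 1) div 3"
    and z: "z \<in> cech_cocycles (curve_ring r :: 'k::field laurent2 set) (curve_gens r) 1"
    and deg: "\<forall>I. z I \<in> curve_grading r j"
  shows "z \<in> cech_coboundaries (curve_ring r) (curve_gens r) 1"
proof -
  obtain f where f: "z = cech_const (curve_gens r) f" "f \<in> monomial_span (curve_saturation r)"
    using z unfolding cech_cocycles_1_iff[OF curve_gens_not_Nil] localization_gens_iff[OF r] by blast
  have "z {0} = f" by (simp add: f(1) cech_const_def)
  then have "f \<in> monomial_span {(a, b). a + b = (2 * int r + 1) * j}"
    using deg by (metis curve_grading_eq)
  with f(2) have "f \<in> monomial_span (curve_saturation r \<inter> {(a, b). a + b = (2 * int r + 1) * j})"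
    by (simp add: monomial_span_Int)
  moreover have "curve_saturation r \<inter> {(a, b). a + b = (2 * int r + 1) * j} \<subseteq> curve_semigroup r"
  proof clarify
    fix a b assume ab: "(a, b) \<in> curve_saturation r" "a + b = (2 * int r + 1) * j"
    show "(a, b) \<in> curve_semigroup r"
    proof (rule ccontr)
      assume "(a, b) \<notin> curve_semigroup r"
      then obtain n where "a + b = (2 * int r + 1) * n" "n \<le> (int r + 1) div 3"
        by (rule curve_saturation_cases[OF r ab(1)])
      then have "(2 * int r + 1) * j = (2 * int r + 1) * n" "n < j" using ab(2) j by simp_all
      then show False unfolding mult_cancel_left by linarith
    qed
  qed
  ultimately have "f \<in> curve_ring r" unfolding curve_ring_eq using monomial_span_mono by blast
  then show ?thesis
    unfolding f(1) cech_const_coboundary_iff[OF curve_gens_not_Nil] .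
qed

lemma curve_H1_nonzero:
  assumes r: "r \<ge> 2" and n: "2 \<le> n" "3 * n \<le> int r + 1"
  shows "\<exists>z\<in>cech_cocycles (curve_ring r :: 'k::field laurent2 set) (curve_gens r) 1.
    (\<forall>I. z I \<in> curve_grading r n) \<and> z \<notin> cech_coboundaries (curve_ring r) (curve_gens r) 1"
proof -
  define f where "f = (st_monom (int r + 2) ((2 * int r + 1) * n - (int r + 2)) :: 'k laurent2)"
  have "f \<in> monomial_span (curve_saturation r)"
    unfolding f_def st_monom_in_span by (rule gap_in_curve_saturation[OF n(1)])
  then have "cech_const (curve_gens r) f \<in> cech_cocycles (curve_ring r) (curve_gens r) 1"
    unfolding cech_cocycles_1_iff[OF curve_gens_not_Nil] localization_gens_iff[OF r]
    by (intro exI[of _ f] conjI refl)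
  moreover have "cech_const (curve_gens r) f I \<in> curve_grading r n" for I
    unfolding curve_grading_eq cech_const_def by (simp add: monomial_span_zero f_def)
  moreover have "f \<notin> curve_ring r"
    unfolding f_def curve_ring_eq st_monom_in_span
    using n r by (intro curve_semigroup_gap[of n]) auto
  then have "cech_const (curve_gens r) f \<notin> cech_coboundaries (curve_ring r) (curve_gens r) 1"
    unfolding cech_const_coboundary_iff[OF curve_gens_not_Nil] .
  ultimately show ?thesis
    by (intro bexI[of _ "cech_const (curve_gens r) f"] conjI allI)
qed

text \<open>
  Only the \<open>s\<close>-exponents \<open>1\<close> and the negative ones violate the condition of the localization at the
  power of \<open>t\<close>. For \<open>1\<close> the exponent of \<open>t\<close> is \<open>2 r\<close> plus a nonnegative multiple of \<open>2 r + 1\<close>, and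
  for negative \<open>s\<close>-exponents it is beyond the conductor bound.
\<close>

lemma localized_cover:
  assumes r: "r \<ge> 2" and j: "j \<ge> (int r + 1) div 3" and ab: "a + b = (2 * int r + 1) * j"
  shows "(a, b) \<in> s_localized r \<union> t_localized r"
proof -
  have lat: "(a, b) \<in> curve_lattice r" by (simp add: curve_lattice_def ab)
  have "j \<ge> 1" using r j by presburger
  consider "a \<ge> 0" "a \<noteq> 1" | "a = 1" | "a < 0" by linarith
  then show ?thesis
  proof cases
    case 1
    then show ?thesis using lat by (simp add: t_localized_def)
  next
    case 2
    then have "b \<in> t_semigroup r" using ab \<open>j \<ge> 1\<close>
      by (intro t_semigroup_interval[of "j - 1" 2]) (auto simp: algebra_simps)
    then show ?thesis using lat by (simp add: s_localized_def)
  next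
    case 3
    have "(2 * int r + 1) * ((int r + 1) div 3) \<le> (2 * int r + 1) * j"
      using j by (intro mult_left_mono) auto
    then have "b \<in> t_semigroup r" using ab 3 by (intro t_semigroup_conductor[OF r]) linarith
    then show ?thesis using lat by (simp add: s_localized_def)
  qed
qed

text \<open>
  The contraction gives a primitive whose value at the last index may fail to lie in the
  localization at the power of \<open>t\<close>. Splitting this value as \<open>g + h\<close> along the two extreme
  localizations and subtracting \<open>g\<close> at all indices corrects it without changing the coboundary.
\<close>

lemma curve_H2_vanishing:
  assumes r: "r \<ge> 2" and j: "j \<ge> (int r + 1) div 3"
    and z: "z \<in> cech_cocycles (curve_ring r :: 'k::field laurent2 set) (curve_gens r) 2"
    and deg: "\<forall>I. z I \<in> curve_grading r j"
  shows "z \<in> cech_coboundaries (curve_ring r) (curve_gens r) 2"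
proof -
  let ?R = "curve_ring r :: 'k laurent2 set"
  let ?w = "cech_contraction z"
  have zI: "if I \<subseteq> {..<5} \<and> card I = 2
      then z I \<in> localization ?R (\<Prod>l\<in>I. curve_gens r ! l) else z I = 0" for I
    using z unfolding cech_cocycles_def cech_cochains_def length_curve_gens by blast
  have w_lattice: "?w {l} \<in> monomial_span (curve_lattice r)" if "l < 5" for l
  proof (cases "l = 0")
    case True
    then show ?thesis by (simp add: cech_contraction_def monomial_span_zero)
  next
    case False
    then have "card {0, l} = 2" "{0, l} \<noteq> {0}" "{0, l} \<noteq> {4}" by auto
    then show ?thesis
      using zI[of "{0, l}"] localization_interior[OF r, of "{0, l}", where 'k = 'k] that False
      by (simp add: cech_contraction_def)
  qed
  have w_zero: "?w I = 0" if "\<not> (\<exists>l<5. I = {l})" for I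
  proof (rule ccontr)
    assume *: "?w I \<noteq> 0"
    then have I0: "0 \<notin> I" and "z (insert 0 I) \<noteq> 0"
      by (auto simp: cech_contraction_def split: if_splits)
    then have I: "I \<subseteq> {..<5}" "card (insert 0 I) = 2"
      using zI[of "insert 0 I"] by (auto split: if_splits)
    then have "finite I" using finite_subset by blast
    then have "card I = 1" using I(2) I0 by simp
    then show False using that I(1) by (auto simp: card_1_singleton_iff)
  qed
  have "z {0, 4} \<in> monomial_span {(a, b). a + b = (2 * int r + 1) * j}"
    using deg by (simp add: curve_grading_eq)
  moreover have "{(a, b). a + b = (2 * int r + 1) * j} \<subseteq> s_localized r \<union> t_localized r"
    using localized_cover[OF r j] by auto
  ultimately have "?w {4} \<in> monomial_span (s_localized r \<union> t_localized r)"
    using monomial_span_mono by (auto simp: cech_contraction_def)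
  then obtain g h where gh: "g \<in> monomial_span (s_localized r)" "h \<in> monomial_span (t_localized r)"
    "?w {4} = g + h"
    using monomial_span_Un by metis
  have g: "g \<in> monomial_span (curve_lattice r)"
    using gh(1) monomial_span_mono[OF s_localized_subset] by blast
  define c where "c I = ?w I - cech_const (curve_gens r) g I" for I
  have "cech_d (curve_gens r) c = z"
    unfolding c_def cech_d_diff cech_d_contraction[OF curve_gens_not_Nil z] cech_d_const by simp
  moreover have "c \<in> cech_cochains ?R (curve_gens r) 1"
    unfolding cech_cochains_def mem_Collect_eq length_curve_gens
  proof
    fix I
    show "if I \<subseteq> {..<5} \<and> card I = 1
      then c I \<in> localization ?R (\<Prod>l\<in>I. curve_gens r ! l) else c I = 0"
    proof (cases "\<exists>l<5. I = {l}")
      case True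
      then obtain l where l: "l < 5" "I = {l}" by blast
      have cI: "c I = ?w {l} - g" using l by (simp add: c_def cech_const_def)
      consider "l = 0" | "l = 4" | "l \<noteq> 0" "l \<noteq> 4" by blast
      then have "c I \<in> localization ?R (curve_gens r ! l)"
      proof cases
        case 1
        then have "c I = 0 - g" using cI by (simp add: cech_contraction_def)
        then show ?thesis
          using 1 monomial_span_diff[OF monomial_span_zero gh(1)] r
          by (simp add: localization_gen)
      next
        case 2
        then have "c I = h" using cI gh(3) by simp
        then show ?thesis using 2 gh(2) r by (simp add: localization_gen)
      next
        case 3
        then show ?thesis
          using l(1) cI monomial_span_diff[OF w_lattice[OF l(1)] g] r by (simp add: localization_gen)
      qed
      then show ?thesis using l by simp
    next
      case False
      then have "\<not> (I \<subseteq> {..<5} \<and> card I = 1)" by (auto simp: card_1_singleton_iff)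
      moreover have "cech_const (curve_gens r) g I = 0"
        unfolding cech_const_def length_curve_gens using False by argo
      then have "c I = 0" using w_zero[OF False] by (simp add: c_def)
      ultimately show ?thesis by argo
    qed
  qed
  ultimately have "z \<in> cech_coboundaries ?R (curve_gens r) (Suc 1)" by auto
  then show ?thesis by (simp add: numeral_2_eq_2)
qed

text \<open>
  From degree \<open>3\<close> on the contraction only involves index sets for which the localization is the span of
  the whole lattice.
\<close>

lemma curve_H3_vanishing:
  assumes r: "r \<ge> 2" and i: "i \<ge> 3"
    and z: "z \<in> cech_cocycles (curve_ring r :: 'k::field laurent2 set) (curve_gens r) i"
  shows "z \<in> cech_coboundaries (curve_ring r) (curve_gens r) i"
proof -
  obtain n where n: "i = Suc n" "n \<ge> 2" using i by (cases i) auto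
  have "z \<in> cech_coboundaries (curve_ring r) (curve_gens r) (Suc n)"
  proof (rule cech_coboundariesI[OF _ curve_ring_subring curve_gens_not_Nil])
    show "z \<in> cech_cocycles (curve_ring r) (curve_gens r) (Suc n)" using z n by simp
    fix I :: "nat set"
    assume I: "I \<subseteq> {..<length (curve_gens r)}" "card I = n" "0 \<notin> I"
    have "I \<noteq> {}" "I \<noteq> {0}" "I \<noteq> {4}" using I(2) n(2) by auto
    moreover from this I(3) have "insert 0 I \<noteq> {0}" "insert 0 I \<noteq> {4}" by auto
    ultimately show "localization (curve_ring r :: 'k laurent2 set) (\<Prod>l\<in>insert 0 I. curve_gens r ! l)
        \<subseteq> localization (curve_ring r) (\<Prod>l\<in>I. curve_gens r ! l)"
      using I(1) localization_interior[OF r, of I, where 'k = 'k]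
        localization_interior[OF r, of "insert 0 I", where 'k = 'k] by simp
  qed
  then show ?thesis using n by simp
qed


section \<open>Regularity\<close>

text \<open>
  The maximum is attained by \<open>H\<^sup>1\<close> in degree \<open>\<lfloor>(r + 1) / 3\<rfloor>\<close>, which is at least \<open>2\<close>.
\<close>

lemma curve_regularity:
  assumes r: "r \<ge> 5"
  shows "cm_regularity (curve_grading r) (curve_ring r :: 'k::field laurent2 set) (curve_gens r)
    = (int r + 1) div 3 + 1"
proof -
  define q where "q = (int r + 1) div 3"
  have q: "q \<ge> 2" "3 * q \<le> int r + 1" using r unfolding q_def by presburger+
  have r2: "r \<ge> 2" using r by simp
  let ?R = "curve_ring r :: 'k laurent2 set"
  let ?B = "cech_coboundaries ?R (curve_gens r)"
  have "0 \<in> (curve_grading r j :: 'k laurent2 set)" for j by (simp add: curve_grading_def)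
  note triv = local_cohomology_deg_trivial_iff[OF curve_ring_subring curve_gens_subset,
      of "curve_grading r", OF this]
  show ?thesis
    unfolding cm_regularity_def q_def[symmetric]
  proof (rule Greatest_equality)
    have "local_cohomology_deg (curve_grading r) ?R (curve_gens r) 1 q \<noteq> {?B 1}"
      using curve_H1_nonzero[OF r2 q, where 'k = 'k] unfolding triv by blast
    then show "\<exists>i j. q + 1 = int i + j \<and>
        local_cohomology_deg (curve_grading r) ?R (curve_gens r) i j \<noteq> {?B i}"
      by (intro exI[of _ 1] exI[of _ q]) simp
  next
    fix n assume "\<exists>i j. n = int i + j \<and>
        local_cohomology_deg (curve_grading r) ?R (curve_gens r) i j \<noteq> {?B i}"
    then obtain i j z where n: "n = int i + j" and z: "z \<in> cech_cocycles ?R (curve_gens r) i"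
      and deg: "\<forall>I. z I \<in> curve_grading r j" and not: "z \<notin> ?B i"
      unfolding triv by blast
    consider "i = 0" | "i = 1" | "i = 2" | "i \<ge> 3" by linarith
    then show "n \<le> q + 1"
    proof cases
      case 1
      then show ?thesis using cech_cocycles_0[OF curve_gens_not_Nil] z not by metis
    next
      case 2
      then have "\<not> j > q" using curve_H1_vanishing[OF r2 _ _ deg] z not unfolding q_def by metis
      then show ?thesis using 2 n by simp
    next
      case 3
      then have "\<not> j \<ge> q" using curve_H2_vanishing[OF r2 _ _ deg] z not unfolding q_def by metis
      then show ?thesis using 3 n by simp
    next
      case 4
      then show ?thesis using curve_H3_vanishing[OF r2 _ z] not by blast
    qed
  qed
qed

theorem theorem6p2:
  fixes r k :: nat
  assumes "r \<ge> 5" and "k \<ge> 1"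
    and "strictly_Buchsbaum (curve_ring r :: 'k::field laurent2 set) (curve_gens r) k"
  shows "cm_regularity (curve_grading r) (curve_ring r :: 'k laurent2 set) (curve_gens r)
           = int k + 2"
proof -
  have "r \<ge> 2" using \<open>r \<ge> 5\<close> by simp
  note ann = curve_annihilates_lc_iff[OF this, where 'k = 'k]
  have "(int r + 1) div 3 \<le> int k + 1" "\<not> (int r + 1) div 3 \<le> int (k - 1) + 1"
    using assms(3) unfolding strictly_Buchsbaum_def ann by blast+
  then have "(int r + 1) div 3 = int k + 1" using \<open>k \<ge> 1\<close> by linarith
  then show ?thesis using curve_regularity[OF \<open>r \<ge> 5\<close>, where 'k = 'k] by simp
qed

end
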